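(* Assume $\delta$ is odd. Let $\sigma\in\mathrm{Aut}(G)$ and $\omega\in E(G)$. Then there is $\omega_0\in E(G)$ with $\sigma(G^{\omega})=G^{\omega_0}$, the unordered pair $\{\omega_0,\overline{\omega_0}\}$ is uniquely determined by $\{\omega,\overline{\omega}\}$, and the rule $\{\omega,\overline{\omega}\}\mapsto\{\omega_0,\overline{\omega_0}\}$ defines an action of $\mathrm{Aut}(G)$ on $\overline{E}(G)$.
   Context: Let $\mathbb{F}_q$ be a finite field, $K$ an algebraic function field in one variable with constant field $\mathbb{F}_q$, $\infty$ a fixed place of $K$ of degree $\delta$, and $A$ the ring of elements of $K$ integral at every place other than $\infty$. Let $G=GL_2(A)$. Let $K_\infty$ be the completion of $K$ at $\infty$, $C_\infty$ the completion of an algebraic closure of $K_\infty$, and $\Omega=C_\infty\setminus K_\infty$ the Drinfeld upper half plane, on which $G$ acts by Möbius transformations. For $\omega\in\Omega$, $G^\omega$ is its stabilizer in $G$. $E(G)$ is the set of elliptic elements: those $\omega\in\Omega$ whose stabilizer $G^\omega$ contains a non-scalar matrix. Every $\omega\in E(G)$ lies in $\widetilde{K}\setminus K$, where $\widetilde{K}=\mathbb{F}_{q^2}K$, and $\overline{\omega}$ denotes its image under the nontrivial element of $\mathrm{Gal}(\widetilde{K}/K)$; then $\overline{\omega}\in E(G)$ and $G^{\overline{\omega}}=G^\omega$. Let $\overline{E}(G)=\{\{\omega,\overline{\omega}\}:\omega\in E(G)\}$ (unordered pairs). *)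

theory Defs
  imports "HOL-Analysis.Analysis" "HOL-Algebra.Algebra" "HOL-Algebra.Algebraic_Closure_Type"
begin

unbundle no Formal_Power_Series.fps_syntax

abbreviation type_ring :: "'a::field ring" (\<open>\<R>\<close>)
  where "\<R> \<equiv> ring_of_type_algebra"

text \<open>
  Subsets of a field type are viewed as substructures of the record \<open>\<R>\<close>, so that the notions of
  HOL-Algebra (subfields, dimension, algebraic elements, algebraic closures, ...) apply.
\<close>

abbreviation sub_ring :: "'a::field set \<Rightarrow> 'a ring"
  where "sub_ring S \<equiv> \<R>\<lparr>carrier := S\<rparr>"


section \<open>Function fields and their places\<close>

text \<open>
  The function field \<open>K\<close> is the whole type \<open>'k\<close>, and \<open>F\<close> is its finite field of constants, which is
  algebraically closed in \<open>K\<close>.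
\<close>

definition function_field :: "'k::field set \<Rightarrow> bool" where
  "function_field F \<longleftrightarrow>
     subfield F \<R> \<and> finite F \<and>
     (\<exists>x. ring.transcendental \<R> F x \<and>
          ring.finite_dimension \<R> (generate_field \<R> (insert x F)) (UNIV :: 'k set)) \<and>
     (\<forall>x. ring.algebraic \<R> F x \<longrightarrow> x \<in> F)"

definition valuation_ring :: "'k::field set \<Rightarrow> 'k set \<Rightarrow> bool" where
  "valuation_ring F V \<longleftrightarrow>
     subring V \<R> \<and> F \<subset> V \<and> V \<subset> UNIV \<and> (\<forall>z. z \<in> V \<or> inverse z \<in> V)"

definition place :: "'k::field set \<Rightarrow> 'k set \<Rightarrow> bool" where
  "place F P \<longleftrightarrow> (\<exists>V. valuation_ring F V \<and> maximalideal P (sub_ring V))"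

text \<open>
  The valuation ring is recovered from the place \<open>P\<close>; \<open>0\<close> is listed separately because
  \<open>inverse 0 = 0\<close> lies in \<open>P\<close>.
\<close>

definition place_ring :: "'k::field set \<Rightarrow> 'k set" where
  "place_ring P = {z. z = 0 \<or> inverse z \<notin> P}"

text \<open>\<open>P\<close> has degree \<open>n\<close>: the residue field has dimension \<open>n\<close> over the image of \<open>F\<close>.\<close>

definition has_degree :: "'k::field set \<Rightarrow> 'k set \<Rightarrow> nat \<Rightarrow> bool" where
  "has_degree F P n \<longleftrightarrow>
     (let V = sub_ring (place_ring P); k = V Quot P
      in ring.dimension k n ((\<lambda>a. P +>\<^bsub>V\<^esub> a) ` F) (carrier k))"

definition integral_away :: "'k::field set \<Rightarrow> 'k set \<Rightarrow> 'k set" where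
  "integral_away F P = {x. \<forall>Q. place F Q \<and> Q \<noteq> P \<longrightarrow> x \<in> place_ring Q}"


section \<open>The fields \<open>K\<^sub>\<infinity>\<close> and \<open>C\<^sub>\<infinity>\<close>\<close>

text \<open>
  Since \<open>C\<close> is complete, the closure of the image of \<open>K\<close> is the completion of \<open>K\<close> for the
  restricted metric.
\<close>

definition K_inf :: "('k::field \<Rightarrow> 'c::{field, complete_space}) \<Rightarrow> 'c set" where
  "K_inf \<iota> = closure (range \<iota>)"

text \<open>
  The complete field \<open>'c\<close>, with the embedding \<open>\<iota>\<close> of \<open>K\<close>, is a completion of an algebraic closure of
  the completion of \<open>K\<close> at the place \<open>P\<close>. The absolute value of \<open>x\<close> is \<open>dist x 0\<close>; it extends an
  absolute value of \<open>K\<close> with valuation ring \<open>place_ring P\<close>. This determines it up to a positive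
  power, so no normalisation is imposed.
\<close>

locale place_completion =
  fixes P :: "'k::field set" and \<iota> :: "'k \<Rightarrow> 'c::{field, complete_space}"
  assumes embedding: "\<iota> \<in> ring_hom \<R> \<R>"
    and dist_diff: "\<And>x y :: 'c. dist x y = dist (x - y) 0"
    and abs_mult: "\<And>x y :: 'c. dist (x * y) 0 = dist x 0 * dist y 0"
    and abs_ultrametric: "\<And>x y :: 'c. dist (x + y) 0 \<le> max (dist x 0) (dist y 0)"
    and abs_place: "\<And>x. dist (\<iota> x) 0 \<le> 1 \<longleftrightarrow> x \<in> place_ring P"
    and dense_algebraic_closure:
      "\<exists>L. algebraic_closure (sub_ring L) (K_inf \<iota>) \<and> closure L = (UNIV :: 'c set)"

definition upper_half_plane :: "('k::field \<Rightarrow> 'c::{field, complete_space}) \<Rightarrow> 'c set" where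
  "upper_half_plane \<iota> = UNIV - K_inf \<iota>"


section \<open>The group \<open>GL\<^sub>2(A)\<close> and its elliptic points\<close>

definition GL2 :: "'k::field set \<Rightarrow> ('k^2^2) monoid" where
  "GL2 A = units_of \<lparr>carrier = {M. \<forall>i j. M $ i $ j \<in> A}, monoid.mult = (**), one = mat 1\<rparr>"

definition moebius_map :: "('k::field \<Rightarrow> 'c::field) \<Rightarrow> 'k^2^2 \<Rightarrow> 'c \<Rightarrow> 'c" where
  "moebius_map \<iota> M z = (\<iota> (M $ 1 $ 1) * z + \<iota> (M $ 1 $ 2)) / (\<iota> (M $ 2 $ 1) * z + \<iota> (M $ 2 $ 2))"

text \<open>The matrices \<open>mat c\<close> are the scalar ones.\<close>

definition elliptic_points ::
    "('k::field \<Rightarrow> 'c::{field, complete_space}) \<Rightarrow> ('k^2^2) monoid \<Rightarrow> 'c set" where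
  "elliptic_points \<iota> G =
     {\<omega> \<in> upper_half_plane \<iota>. \<exists>M \<in> stabilizer G (moebius_map \<iota>) \<omega>. M \<notin> range mat}"


section \<open>Conjugation in the quadratic constant field extension\<close>

text \<open>
  With \<open>q = card F\<close>, the subfield of \<open>C\<close> with \<open>q\<^sup>2\<close> elements is the set of solutions of
  \<open>x ^ q\<^sup>2 = x\<close>.
\<close>

definition K_tilde :: "'k::field set \<Rightarrow> ('k \<Rightarrow> 'c::field) \<Rightarrow> 'c set" where
  "K_tilde F \<iota> = generate_field \<R> ({x. x ^ ((card F)\<^sup>2) = x} \<union> range \<iota>)"

definition Gal :: "'a::field set \<Rightarrow> 'a set \<Rightarrow> ('a \<Rightarrow> 'a) set" where
  "Gal E k = {\<tau> \<in> extensional E. \<tau> \<in> ring_iso (sub_ring E) (sub_ring E) \<and> (\<forall>x\<in>k. \<tau> x = x)}"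

definition conj_pt :: "'k::field set \<Rightarrow> ('k \<Rightarrow> 'c::field) \<Rightarrow> 'c \<Rightarrow> 'c" where
  "conj_pt F \<iota> =
     (THE \<tau>. \<tau> \<in> Gal (K_tilde F \<iota>) (range \<iota>) \<and> \<tau> \<noteq> (\<lambda>x\<in>K_tilde F \<iota>. x))"

definition elliptic_pairs ::
    "'k::field set \<Rightarrow> ('k \<Rightarrow> 'c::{field, complete_space}) \<Rightarrow> ('k^2^2) monoid \<Rightarrow> 'c set set" where
  "elliptic_pairs F \<iota> G = {{\<omega>, conj_pt F \<iota> \<omega>} | \<omega>. \<omega> \<in> elliptic_points \<iota> G}"

end

theory Submission
  imports Defs
begin

text \<open>
  Let \<open>\<omega>\<close> be elliptic and \<open>M\<close> a non-scalar matrix fixing it. Both eigenvalues of \<open>M\<close> lie outside \<open>K\<^sub>\<infinity>\<close>, so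
  they have the same absolute value (otherwise the dominant one would be a limit of elements of \<open>K\<close>).
  As \<open>det M\<close> is a unit of \<open>A\<close>, hence a constant, the trace of \<open>M\<close> is integral at every place and is
  a constant too. The eigenvalues therefore lie in the field with \<open>q\<^sup>2\<close> elements but not in \<open>F\<close>, which
  says that \<open>M ^ (q\<^sup>2 - 1) = 1\<close> and \<open>M ^ (q - 1) \<noteq> 1\<close>. Conversely, as soon as one elliptic point exists,
  these two conditions force a non-scalar matrix in \<open>G\<close> to fix an elliptic point. Moreover the
  stabilizer of \<open>\<omega>\<close> is the centralizer of \<open>M\<close>. All of this is preserved by automorphisms of \<open>G\<close>.
  Finally, the two fixed points of \<open>M\<close> are \<open>\<omega>\<close> and its conjugate, so the stabilizer determines the pair.
\<close>

section \<open>Places of a function field\<close>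

text \<open>An automorphism \<open>\<sigma>\<close> is only an abstract bijection and is not assumed
  to come from a map of the half plane, so ellipticity has to be recognised from products and powers
  in \<open>G\<close>. The two exponents are the orders of the multiplicative groups of the fields
  with \<open>q\<^sup>2\<close> and \<open>q\<close> elements. For the converse direction, the
  eigenvalue \<open>l\<close> of one given elliptic matrix is what matters: every element of the
  field with \<open>q\<^sup>2\<close> elements is \<open>x + y l\<close> with \<open>x\<close>,
  \<open>y\<close> in \<open>F\<close>, and so lies either in \<open>F\<close> or outside
  \<open>K_inf\<close>. Being non-scalar must also be transported. A scalar image would be central,
  whereas stabilizers are proper subgroups because the translation by one fixes no point. The
  arithmetic input is that an element integral at every place is constant. This needs enough places
  to exist, which is why Chevalley's extension theorem for valuation rings comes in.\<close>

lemma type_ring_simps [simp]: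
  "carrier (\<R> :: 'a::field ring) = UNIV"
  "x \<otimes>\<^bsub>\<R>\<^esub> y = (x * y :: 'a)"
  "\<one>\<^bsub>\<R>\<^esub> = (1 :: 'a)"
  "\<zero>\<^bsub>\<R>\<^esub> = (0 :: 'a)"
  "x \<oplus>\<^bsub>\<R>\<^esub> y = (x + y :: 'a)"
  by (auto simp: ring_of_type_algebra_def)

interpretation type_ring: cring "\<R> :: 'a::field ring"
  by (rule cring_from_type_algebra)

lemma a_inv_type_ring [simp]: "\<ominus>\<^bsub>\<R>\<^esub> x = (- x :: 'a::field)"
  by (rule type_ring.minus_equality) auto

lemma m_inv_type_ring: "x \<noteq> 0 \<Longrightarrow> inv\<^bsub>\<R>\<^esub> x = (inverse x :: 'a::field)"
  by (rule type_ring.comm_inv_char) auto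

lemma subring_type_iff:
  "subring V (\<R> :: 'a::field ring) \<longleftrightarrow>
     1 \<in> V \<and> (\<forall>x\<in>V. - x \<in> V) \<and> (\<forall>x\<in>V. \<forall>y\<in>V. x * y \<in> V) \<and> (\<forall>x\<in>V. \<forall>y\<in>V. x + y \<in> V)"
proof
  assume "subring V (\<R> :: 'a ring)"
  from subringE[OF this] show "1 \<in> V \<and> (\<forall>x\<in>V. - x \<in> V) \<and> (\<forall>x\<in>V. \<forall>y\<in>V. x * y \<in> V)
     \<and> (\<forall>x\<in>V. \<forall>y\<in>V. x + y \<in> V)"
    by simp
qed (auto intro!: type_ring.subringI)

lemma subring_typeD:
  assumes "subring V (\<R> :: 'a::field ring)"
  shows "0 \<in> V" "1 \<in> V" "x \<in> V \<Longrightarrow> - x \<in> V" "x \<in> V \<Longrightarrow> y \<in> V \<Longrightarrow> x * y \<in> V"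
    "x \<in> V \<Longrightarrow> y \<in> V \<Longrightarrow> x + y \<in> V" "x \<in> V \<Longrightarrow> y \<in> V \<Longrightarrow> x - y \<in> V"
    "x \<in> V \<Longrightarrow> x ^ n \<in> V"
proof -
  note S = assms[unfolded subring_type_iff]
  show 1: "1 \<in> V" and "x \<in> V \<Longrightarrow> - x \<in> V" "x \<in> V \<Longrightarrow> y \<in> V \<Longrightarrow> x * y \<in> V"
    "x \<in> V \<Longrightarrow> y \<in> V \<Longrightarrow> x + y \<in> V"
    using S by auto
  show "0 \<in> V" using subringE(2)[OF assms] by simp
  show "x \<in> V \<Longrightarrow> y \<in> V \<Longrightarrow> x - y \<in> V"
    using S by (metis diff_conv_add_uminus)
  show "x \<in> V \<Longrightarrow> x ^ n \<in> V" by (induction n) (use S in auto)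
qed

lemma subring_type_sum:
  assumes "subring V (\<R> :: 'a::field ring)" "\<And>i. i \<in> I \<Longrightarrow> f i \<in> V"
  shows "(\<Sum>i\<in>I. f i) \<in> V"
  using assms(2) by (induction I rule: infinite_finite_induct) (auto simp: subring_typeD[OF assms(1)])

lemma subfield_inverse:
  assumes "subfield F (\<R> :: 'a::field ring)" "x \<in> F"
  shows "inverse x \<in> F"
proof (cases "x = 0")
  case False
  then show ?thesis
    using type_ring.subfield_m_inv(1)[OF assms(1), of x] assms(2) by (simp add: m_inv_type_ring)
qed (use assms in auto)

subsection \<open>Chevalley's extension theorem\<close>

text \<open>The filtration by degree of the subring \<open>R[z]\<close> of the field. The bound
  \<open>n\<close> is the quantity that the descent below decreases.\<close>

definition poly_values :: "'a::field set \<Rightarrow> 'a \<Rightarrow> nat \<Rightarrow> 'a set" where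
  "poly_values R z n =
     {poly p z | p. Polynomial.degree p \<le> n \<and> (\<forall>i. Polynomial.coeff p i \<in> R)}"

context
  fixes R :: "'a::field set"
  assumes R: "subring R (\<R> :: 'a ring)"
begin

lemma poly_values_monomial:
  assumes "i \<le> n" "r \<in> R"
  shows "r * z ^ i \<in> poly_values R z n"
proof -
  have "r * z ^ i = poly (Polynomial.monom r i) z" by (simp add: poly_monom)
  moreover have "Polynomial.degree (Polynomial.monom r i) \<le> n"
    using degree_monom_le[of r i] assms by linarith
  ultimately show ?thesis
    unfolding poly_values_def using assms subring_typeD(1)[OF R]
    by (intro CollectI exI[of _ "Polynomial.monom r i"]) auto
qed

lemma poly_values_0: "poly_values R z 0 = R"
proof
  show "poly_values R z 0 \<subseteq> R"
  proof
    fix x assume "x \<in> poly_values R z 0"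
    then obtain p where p: "x = poly p z" "Polynomial.degree p = 0" "\<forall>i. Polynomial.coeff p i \<in> R"
      by (auto simp: poly_values_def)
    from degree_eq_zeroE[OF p(2)] obtain a where "p = [:a:]" by metis
    with p(1,3) show "x \<in> R" by (metis coeff_pCons_0 mult_zero_right poly_0 poly_pCons add.right_neutral)
  qed
  show "R \<subseteq> poly_values R z 0"
    using poly_values_monomial[of 0 0 _ z] by auto
qed

lemma poly_values_mono: "m \<le> n \<Longrightarrow> poly_values R z m \<subseteq> poly_values R z n"
  by (auto simp: poly_values_def)

lemma poly_values_add:
  assumes "x \<in> poly_values R z n" "y \<in> poly_values R z n"
  shows "x + y \<in> poly_values R z n"
proof -
  from assms(1) obtain p where p: "x = poly p z" "Polynomial.degree p \<le> n" "\<forall>i. Polynomial.coeff p i \<in> R"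
    unfolding poly_values_def by blast
  from assms(2) obtain q where q: "y = poly q z" "Polynomial.degree q \<le> n" "\<forall>i. Polynomial.coeff q i \<in> R"
    unfolding poly_values_def by blast
  show ?thesis
    unfolding poly_values_def
    by (intro CollectI exI[of _ "p + q"]) (use p q in \<open>auto intro: degree_add_le subring_typeD[OF R]\<close>)
qed

lemma poly_values_mult:
  assumes "x \<in> poly_values R z m" "y \<in> poly_values R z n"
  shows "x * y \<in> poly_values R z (m + n)"
proof -
  from assms(1) obtain p where p: "x = poly p z" "Polynomial.degree p \<le> m" "\<forall>i. Polynomial.coeff p i \<in> R"
    unfolding poly_values_def by blast
  from assms(2) obtain q where q: "y = poly q z" "Polynomial.degree q \<le> n" "\<forall>i. Polynomial.coeff q i \<in> R"
    unfolding poly_values_def by blast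
  have "Polynomial.degree (p * q) \<le> m + n"
    using p q degree_mult_le[of p q] by linarith
  then show ?thesis
    unfolding poly_values_def
    by (intro CollectI exI[of _ "p * q"])
       (use p q in \<open>auto simp: coeff_mult intro!: subring_typeD[OF R] subring_type_sum[OF R]\<close>)
qed

lemma poly_values_sum:
  assumes "\<And>i. i \<in> I \<Longrightarrow> f i \<in> poly_values R z n"
  shows "(\<Sum>i\<in>I. f i) \<in> poly_values R z n"
  using assms
proof (induction I rule: infinite_finite_induct)
  case (insert i I)
  then show ?case by (auto intro: poly_values_add)
qed (use poly_values_monomial[of 0 n 0 z] subring_typeD(1)[OF R] in auto)

lemma poly_values_sumE:
  assumes "x \<in> poly_values R z n"
  obtains a where "\<And>i. a i \<in> R" "x = (\<Sum>i\<le>n. a i * z ^ i)"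
proof -
  from assms obtain p where p: "x = poly p z" "Polynomial.degree p \<le> n" "\<forall>i. Polynomial.coeff p i \<in> R"
    by (auto simp: poly_values_def)
  have "poly p z = (\<Sum>i\<le>n. Polynomial.coeff p i * z ^ i)"
    unfolding poly_altdef
    by (rule sum.mono_neutral_left) (use p in \<open>auto simp: coeff_eq_0\<close>)
  with p that show ?thesis by blast
qed

lemma subring_poly_values: "subring (\<Union>n. poly_values R z n) (\<R> :: 'a ring)"
  unfolding subring_type_iff
proof (intro conjI ballI)
  show "1 \<in> (\<Union>n. poly_values R z n)"
    using poly_values_0[of z] subring_typeD(2)[OF R] by blast
next
  fix x assume "x \<in> (\<Union>n. poly_values R z n)"
  then obtain n where n: "x \<in> poly_values R z n" by blast
  have "- 1 \<in> poly_values R z 0"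
    using subring_typeD(2,3)[OF R] by (simp add: poly_values_0)
  from poly_values_mult[OF this n] show "- x \<in> (\<Union>n. poly_values R z n)" by auto
next
  fix x y assume "x \<in> (\<Union>n. poly_values R z n)" "y \<in> (\<Union>n. poly_values R z n)"
  then obtain m n where mn: "x \<in> poly_values R z m" "y \<in> poly_values R z n" by blast
  then show "x * y \<in> (\<Union>n. poly_values R z n)"
    using poly_values_mult by blast
  have "x \<in> poly_values R z (max m n)" "y \<in> poly_values R z (max m n)"
    using mn poly_values_mono[of m "max m n"] poly_values_mono[of n "max m n"] by auto
  then show "x + y \<in> (\<Union>n. poly_values R z n)"
    using poly_values_add by blast
qed

text \<open>
  If \<open>inverse x = s\<^sub>0 + s\<^sub>1 w + \<dots> + s\<^sub>m w\<^sup>m\<close>, then \<open>(1 - x s\<^sub>0) z\<^sup>n\<close> is a polynomial in \<open>z = inverse w\<close> of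
  degree less than \<open>n\<close>; this lowers the degree of any polynomial expression of \<open>inverse x\<close> in \<open>z\<close>.
\<close>
lemma poly_values_descent:
  assumes x: "x \<in> R" "inverse x \<notin> R"
    and z: "z \<noteq> 0" "inverse x \<in> poly_values R z n" "inverse x \<in> poly_values R (inverse z) m"
    and mn: "m \<le> n"
  shows "\<exists>n'<n. inverse x \<in> poly_values R z n'"
proof -
  have x0: "x \<noteq> 0" using x subring_typeD(1)[OF R] by auto
  have "n \<noteq> 0" using z(2) x(2) poly_values_0 by metis
  then obtain n' where n': "n = Suc n'" by (cases n) auto
  obtain a where a: "\<And>i. a i \<in> R" "inverse x = (\<Sum>i\<le>n. a i * z ^ i)"
    using poly_values_sumE[OF z(2)] by metis
  obtain s where s: "\<And>i. s i \<in> R" "inverse x = (\<Sum>j\<le>m. s j * inverse z ^ j)"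
    using poly_values_sumE[OF z(3)] by metis
  define c where "c = 1 - x * s 0"
  have cR: "c \<in> R" unfolding c_def by (intro subring_typeD[OF R] x s(1))
  have "c = x * (inverse x - s 0)" using x0 by (simp add: c_def algebra_simps)
  also have "inverse x - s 0 = (\<Sum>j\<in>{1..m}. s j * inverse z ^ j)"
  proof -
    have "{..m} = insert 0 {1..m}" by auto
    then show ?thesis unfolding s(2) by simp
  qed
  finally have c: "c = (\<Sum>j\<in>{1..m}. x * s j * inverse z ^ j)"
    by (simp add: sum_distrib_left mult.assoc)
  have "c * z ^ n = (\<Sum>j\<in>{1..m}. x * s j * z ^ (n - j))"
    unfolding c sum_distrib_right
    by (rule sum.cong) (use mn z(1) in \<open>auto simp: field_simps power_diff\<close>)
  also have "\<dots> \<in> poly_values R z n'"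
    by (intro poly_values_sum poly_values_monomial subring_typeD[OF R] x s(1)) (auto simp: n')
  finally have top: "c * z ^ n \<in> poly_values R z n'" .
  have "inverse x = s 0 + c * inverse x" using x0 by (simp add: c_def algebra_simps)
  also have "c * inverse x = (\<Sum>i\<le>n'. (c * a i) * z ^ i) + a n * (c * z ^ n)"
    unfolding a(2) n' by (simp add: sum_distrib_left algebra_simps)
  finally have e: "inverse x = s 0 * z ^ 0 + ((\<Sum>i\<le>n'. (c * a i) * z ^ i) + a n * (c * z ^ n))"
    by simp
  have "a n * (c * z ^ n) \<in> poly_values R z (0 + n')"
    by (rule poly_values_mult[OF _ top]) (use a(1) poly_values_0 in auto)
  then have "inverse x \<in> poly_values R z n'"
    by (subst e, intro poly_values_add poly_values_sum poly_values_monomial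
          subring_typeD[OF R] cR a(1) s(1)) auto
  then show ?thesis using n' by auto
qed

end

text \<open>Zorn's lemma gives a subring \<open>V\<close> maximal among those containing
  \<open>S\<close> but not \<open>inverse x\<close>. If neither \<open>z\<close> nor
  \<open>inverse z\<close> lay in \<open>V\<close>, then \<open>inverse x\<close> would be a
  polynomial in each of them, and descent on the minimal degrees gives a contradiction.\<close>

lemma chevalley_extension:
  fixes S :: "'a::field set"
  assumes S: "subring S (\<R> :: 'a ring)" and x: "x \<in> S" "inverse x \<notin> S"
  obtains V where "subring V (\<R> :: 'a ring)" "S \<subseteq> V" "inverse x \<notin> V"
    "\<And>z. z \<in> V \<or> inverse z \<in> V"
proof -
  define \<A> where "\<A> = {V. subring V (\<R> :: 'a ring) \<and> S \<subseteq> V \<and> inverse x \<notin> V}"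
  have "\<exists>V\<in>\<A>. \<forall>W\<in>\<A>. V \<subseteq> W \<longrightarrow> W = V"
  proof (rule subset_Zorn_nonempty)
    show "\<A> \<noteq> {}" using S x by (auto simp: \<A>_def)
    fix \<C> assume \<C>: "\<C> \<noteq> {}" "subset.chain \<A> \<C>"
    have sub: "subring V \<R>" "S \<subseteq> V" "inverse x \<notin> V" if "V \<in> \<C>" for V
      using \<C>(2) that by (auto simp: subset_chain_def \<A>_def)
    have dir: "\<exists>V\<in>\<C>. a \<in> V \<and> b \<in> V" if ab: "a \<in> \<Union>\<C>" "b \<in> \<Union>\<C>" for a b
    proof -
      from ab obtain U W where "U \<in> \<C>" "W \<in> \<C>" "a \<in> U" "b \<in> W" by blast
      moreover have "U \<subseteq> W \<or> W \<subseteq> U"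
        using \<C>(2) calculation by (auto simp: subset_chain_def)
      ultimately show ?thesis by blast
    qed
    have "subring (\<Union>\<C>) (\<R> :: 'a ring)"
      unfolding subring_type_iff
    proof (intro conjI ballI)
      show "1 \<in> \<Union>\<C>" using \<C>(1) sub(1) subring_typeD(2) by blast
      show "- a \<in> \<Union>\<C>" if "a \<in> \<Union>\<C>" for a using that sub(1) subring_typeD(3) by blast
      show "a * b \<in> \<Union>\<C>" if "a \<in> \<Union>\<C>" "b \<in> \<Union>\<C>" for a b
        using dir[OF that] sub(1) subring_typeD(4) by blast
      show "a + b \<in> \<Union>\<C>" if "a \<in> \<Union>\<C>" "b \<in> \<Union>\<C>" for a b
        using dir[OF that] sub(1) subring_typeD(5) by blast
    qed
    moreover have "S \<subseteq> \<Union>\<C>" using \<C>(1) sub(2) by blast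
    ultimately show "\<Union>\<C> \<in> \<A>" using sub(3) by (auto simp: \<A>_def)
  qed
  then obtain V where VA: "V \<in> \<A>" and VM: "\<forall>W\<in>\<A>. V \<subseteq> W \<longrightarrow> W = V" ..
  have V: "subring V (\<R> :: 'a ring)" "S \<subseteq> V" "inverse x \<notin> V"
    using VA by (simp_all add: \<A>_def)
  have max: "W = V" if "subring W (\<R> :: 'a ring)" "V \<subseteq> W" "inverse x \<notin> W" for W
    using VM that V(2) by (simp add: \<A>_def)
  \<comment> \<open>Otherwise \<open>V[z]\<close> would be a strictly larger subring still avoiding
    \<open>inverse x\<close>.\<close>
  have adj: "\<exists>n. inverse x \<in> poly_values V z n" if "z \<notin> V" for z
  proof (rule ccontr)
    assume no: "\<nexists>n. inverse x \<in> poly_values V z n"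
    have "(\<Union>n. poly_values V z n) = V"
    proof (rule max[OF subring_poly_values[OF V(1)]])
      show "V \<subseteq> (\<Union>n. poly_values V z n)" using poly_values_0[OF V(1)] by blast
    qed (use no in auto)
    moreover have "z \<in> poly_values V z 1"
      using poly_values_monomial[OF V(1), of 1 1 1 z] subring_typeD(2)[OF V(1)] by simp
    ultimately show False using that by blast
  qed
  have "z \<in> V \<or> inverse z \<in> V" for z
  proof (rule ccontr)
    assume z: "\<not> (z \<in> V \<or> inverse z \<in> V)"
    \<comment> \<open>\<open>n y\<close> is the least degree in which \<open>inverse x\<close> is a
      polynomial in \<open>y\<close>; the larger of \<open>n z\<close> and
      \<open>n (inverse z)\<close> can be lowered.\<close>
    define n where "n = (\<lambda>z. LEAST n. inverse x \<in> poly_values V z n)"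
    have n: "inverse x \<in> poly_values V y (n y)" "\<And>k. k < n y \<Longrightarrow> inverse x \<notin> poly_values V y k"
      if "y \<notin> V" for y
      unfolding n_def using LeastI_ex[OF adj[OF that]] by (auto dest: not_less_Least)
    have z0: "z \<noteq> 0" using z subring_typeD(1)[OF V(1)] by auto
    have xV: "x \<in> V" using x V by auto
    have zz: "z \<notin> V" "inverse z \<notin> V" using z by auto
    show False
    proof (cases "n (inverse z) \<le> n z")
      case True
      then have "\<exists>n'<n z. inverse x \<in> poly_values V z n'"
        by (rule poly_values_descent[OF V(1) xV V(3) z0 n(1)[OF zz(1)] n(1)[OF zz(2)]])
      with n(2)[OF zz(1)] show False by blast
    next
      case False
      then have "\<exists>n'<n (inverse z). inverse x \<in> poly_values V (inverse z) n'"
        using n(1)[OF zz(1)] z0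
        by (intro poly_values_descent[OF V(1) xV V(3) _ n(1)[OF zz(2)], of "n z"]) auto
      with n(2)[OF zz(2)] show False by blast
    qed
  qed
  then show ?thesis by (rule that[OF V])
qed

subsection \<open>Valuation rings and places\<close>

lemma ideal_sub_ring_iff:
  assumes "subring V (\<R> :: 'a::field ring)"
  shows "ideal I (sub_ring V) \<longleftrightarrow>
    I \<subseteq> V \<and> 0 \<in> I \<and> (\<forall>x\<in>I. \<forall>y\<in>I. x + y \<in> I) \<and> (\<forall>x\<in>I. \<forall>v\<in>V. v * x \<in> I)"
proof
  assume "ideal I (sub_ring V)"
  then interpret ideal I "sub_ring V" .
  show "I \<subseteq> V \<and> 0 \<in> I \<and> (\<forall>x\<in>I. \<forall>y\<in>I. x + y \<in> I) \<and> (\<forall>x\<in>I. \<forall>v\<in>V. v * x \<in> I)"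
    using a_subset I_l_closed additive_subgroup.zero_closed[OF is_additive_subgroup]
      additive_subgroup.a_closed[OF is_additive_subgroup] by auto
next
  assume I: "I \<subseteq> V \<and> 0 \<in> I \<and> (\<forall>x\<in>I. \<forall>y\<in>I. x + y \<in> I) \<and> (\<forall>x\<in>I. \<forall>v\<in>V. v * x \<in> I)"
  have rV: "ring (sub_ring V)" by (rule type_ring.subring_is_ring[OF assms])
  then interpret rV: ring "sub_ring V" .
  show "ideal I (sub_ring V)"
  proof (rule idealI[OF rV])
    show "subgroup I (add_monoid (sub_ring V))"
    proof (rule rV.add.subgroupI)
      fix a assume a: "a \<in> I"
      have "- 1 \<in> V" using subring_typeD(2,3)[OF assms] by blast
      then have "- a \<in> I" using I a by (metis mult_minus1)
      moreover have "\<ominus>\<^bsub>sub_ring V\<^esub> a = - a"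
        by (rule rV.minus_equality) (use a I calculation in auto)
      ultimately show "\<ominus>\<^bsub>sub_ring V\<^esub> a \<in> I" by simp
    qed (use I in auto)
  qed (use I in \<open>auto simp: mult.commute\<close>)
qed

text \<open>Of two nonzero elements one divides the other in \<open>V\<close>, so sums of nonunits
  are nonunits and these form an ideal. An ideal containing a unit is all of \<open>V\<close>, which
  leaves a single maximal ideal.\<close>

lemma maximalideal_valuation_ring_iff:
  fixes V :: "'a::field set"
  assumes V: "subring V \<R>" "\<And>z. z \<in> V \<or> inverse z \<in> V"
  shows "maximalideal Q (sub_ring V) \<longleftrightarrow> Q = {z. z = 0 \<or> inverse z \<notin> V}"
proof -
  let ?N = "{z. z = 0 \<or> inverse z \<notin> V}"
  note S = subring_typeD[OF V(1)]
  have N: "ideal ?N (sub_ring V)"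
    unfolding ideal_sub_ring_iff[OF V(1)]
  proof (intro conjI ballI)
    show "?N \<subseteq> V" using V(2) S(1) by auto
    show "0 \<in> ?N" by simp
    have mul: "v * x \<in> ?N" if x: "x \<in> ?N" and v: "v \<in> V" for x v
    proof (rule ccontr)
      assume "v * x \<notin> ?N"
      then have "v \<noteq> 0" "x \<noteq> 0" "inverse (v * x) \<in> V" by auto
      then have "v * inverse (v * x) \<in> V" using v S(4) by blast
      with \<open>v \<noteq> 0\<close> \<open>x \<noteq> 0\<close> x show False by (simp add: field_simps)
    qed
    then show "v * x \<in> ?N" if "x \<in> ?N" "v \<in> V" for x v using that by blast
    have *: "x + y \<in> ?N" if xy: "x \<in> ?N" "y \<in> ?N" and "y \<noteq> 0" "inverse (y / x) \<in> V" for x y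
    proof -
      have "x + y = (1 + inverse (y / x)) * y" using that(3) by (simp add: field_simps)
      then show ?thesis using mul[OF xy(2), of "1 + inverse (y / x)"] S(2,5) that(4) by auto
    qed
    show "x + y \<in> ?N" if xy: "x \<in> ?N" "y \<in> ?N" for x y
    proof (cases "x = 0 \<or> y = 0")
      case False
      with V(2)[of "y / x"] *[OF xy] *[OF xy(2,1)] show ?thesis
        by (auto simp: add.commute)
    qed (use xy in auto)
  qed
  have all: "J = V" if J: "ideal J (sub_ring V)" and "\<not> J \<subseteq> ?N" for J
  proof -
    from that obtain x where x: "x \<in> J" "x \<noteq> 0" "inverse x \<in> V" by auto
    have "1 \<in> J" using x J unfolding ideal_sub_ring_iff[OF V(1)]
      by (metis left_inverse)
    then show ?thesis using J unfolding ideal_sub_ring_iff[OF V(1)]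
      by (metis mult.right_neutral subsetI subset_antisym)
  qed
  show ?thesis
  proof
    assume "maximalideal Q (sub_ring V)"
    then interpret maximalideal Q "sub_ring V" .
    have "Q \<subseteq> ?N" using all[OF ideal_axioms] I_notcarr by auto
    moreover have "?N \<subseteq> V" using V(2) S(1) by auto
    moreover have "?N \<noteq> V"
    proof -
      have "1 \<notin> ?N" using S(2) by simp
      with S(2) show ?thesis by blast
    qed
    ultimately show "Q = ?N" using I_maximal[OF N] by auto
  next
    assume Q: "Q = ?N"
    show "maximalideal Q (sub_ring V)"
    proof (rule maximalidealI)
      show "ideal Q (sub_ring V)" using N Q by simp
      have "1 \<notin> Q" using S(2) by (simp add: Q)
      with S(2) show "carrier (sub_ring V) \<noteq> Q" by auto
      fix J assume "ideal J (sub_ring V)" "Q \<subseteq> J"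
      then show "J = Q \<or> J = carrier (sub_ring V)" using all[of J] Q by auto
    qed
  qed
qed

lemma place_ring_nonunits:
  assumes "subring V (\<R> :: 'a::field ring)"
  shows "place_ring {z. z = 0 \<or> inverse z \<notin> V} = V"
  using subring_typeD(1)[OF assms] by (auto simp: place_ring_def)

text \<open>A valuation ring is recovered from its maximal ideal, so the quantifier over rings in
  \<open>place\<close> can be replaced by the explicit ring \<open>place_ring Q\<close>.\<close>

lemma place_iff:
  "place F Q \<longleftrightarrow> valuation_ring F (place_ring Q) \<and> Q = {z. z = 0 \<or> inverse z \<notin> place_ring Q}"
proof -
  have "place F Q \<longleftrightarrow> (\<exists>V. valuation_ring F V \<and> Q = {z. z = 0 \<or> inverse z \<notin> V})"
    unfolding place_def
    by (intro ex_cong1 conj_cong refl maximalideal_valuation_ring_iff) (auto simp: valuation_ring_def)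
  also have "\<dots> \<longleftrightarrow> valuation_ring F (place_ring Q) \<and> Q = {z. z = 0 \<or> inverse z \<notin> place_ring Q}"
  proof
    assume "\<exists>V. valuation_ring F V \<and> Q = {z. z = 0 \<or> inverse z \<notin> V}"
    then obtain V where V: "valuation_ring F V" "Q = {z. z = 0 \<or> inverse z \<notin> V}" by blast
    then have sV: "subring V \<R>" by (simp add: valuation_ring_def)
    have "place_ring Q = V" unfolding V(2) by (rule place_ring_nonunits[OF sV])
    with V show "valuation_ring F (place_ring Q) \<and> Q = {z. z = 0 \<or> inverse z \<notin> place_ring Q}"
      by simp
  qed blast
  finally show ?thesis .
qed

lemma place_subringD:
  assumes "place F Q"
  shows "subring (place_ring Q) \<R>" "F \<subseteq> place_ring Q"
  using assms by (auto simp: place_iff valuation_ring_def)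

lemma subring_integral_away: "subring (integral_away F P) \<R>"
  using place_subringD(1)[of F]
  by (auto simp: integral_away_def subring_type_iff)

text \<open>\<open>F[x]\<close> is a polynomial ring, so it does not contain
  \<open>inverse x\<close>, and Chevalley's theorem extends it to a valuation ring in which
  \<open>x\<close> is a nonunit. This is a zero of \<open>x\<close>, hence a pole of
  \<open>inverse x\<close>.\<close>

lemma transcendental_imp_pole:
  fixes F :: "'k::field set"
  assumes F: "subfield F \<R>" and tr: "ring.transcendental \<R> F x"
  obtains V where "valuation_ring F V" "x \<in> V" "inverse x \<notin> V"
proof -
  define S where "S = type_ring.simple_extension F x"
  have Fs: "subring F \<R>" by (rule subfieldE(1)[OF F])
  have S: "subring S \<R>" unfolding S_def
    using domain.simple_extension_is_subring[OF field.axioms(1)[OF field_from_type_algebra], OF Fs] by simp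
  have FS: "F \<subseteq> S" unfolding S_def by (rule type_ring.simple_extension_incl) auto
  have xS: "x \<in> S" unfolding S_def by (rule type_ring.simple_extension_mem[OF Fs]) auto
  have alg: "p = []" if "p \<in> carrier (univ_poly \<R> F)" "type_ring.eval p x = 0" for p
    using type_ring.eval_transcendental[of F x p] tr that by (simp add: over_def)
  have x0: "x \<noteq> 0"
  proof
    assume "x = 0"
    then have "type_ring.eval [1, 0] x = 0" by simp
    moreover have "[1, 0] \<in> carrier (univ_poly \<R> F)"
      using subring_typeD[OF Fs] by (simp add: univ_poly_def polynomial_def)
    ultimately show False using alg by blast
  qed
  have "inverse x \<notin> S"
  proof
    assume "inverse x \<in> S"
    then obtain p where p: "p \<in> carrier (univ_poly \<R> F)" "type_ring.eval p x = inverse x"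
      unfolding S_def by (subst (asm) type_ring.simple_extension_as_eval_img) auto
    have "p \<noteq> []" using p(2) x0 by auto
    \<comment> \<open>Coefficient lists start with the leading term, so appending \<open>- 1\<close>
      forms \<open>X p - 1\<close>, which vanishes at \<open>x\<close> because \<open>p\<close> has
      the value \<open>inverse x\<close> there.\<close>
    then have "p @ [- 1] \<in> carrier (univ_poly \<R> F)"
      using p(1) subring_typeD[OF Fs] by (auto simp: univ_poly_def polynomial_def)
    moreover have "type_ring.eval (p @ [- 1]) x = 0"
      by (subst type_ring.eval_append_aux) (use p(2) x0 in auto)
    ultimately show False using alg by blast
  qed
  then obtain V where
    V: "subring V \<R>" "S \<subseteq> V" "inverse x \<notin> V" "\<And>z. z \<in> V \<or> inverse z \<in> V"
    by (rule chevalley_extension[OF S xS]) (rule that)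
  have "x \<notin> F" using subfield_inverse[OF F] V(2,3) FS by auto
  then have "valuation_ring F V"
    unfolding valuation_ring_def using V FS xS by auto
  then show ?thesis by (rule that) (use V xS in auto)
qed

lemma transcendental_inverse:
  fixes F :: "'k::field set"
  assumes "function_field F" "x \<notin> F"
  shows "ring.transcendental \<R> F (inverse x)"
proof -
  have "inverse x \<notin> F"
    using assms subfield_inverse[of F "inverse x"] by (auto simp: function_field_def)
  then show ?thesis
    using assms by (auto simp: function_field_def)
qed

lemma nonconstant_has_pole:
  fixes F :: "'k::field set"
  assumes "function_field F" "x \<notin> F"
  obtains Q where "place F Q" "x \<notin> place_ring Q" "inverse x \<in> place_ring Q"
proof -
  have "subfield F \<R>" using assms by (simp add: function_field_def)
  then obtain V where V: "valuation_ring F V" "inverse x \<in> V" "inverse (inverse x) \<notin> V"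
    by (rule transcendental_imp_pole[OF _ transcendental_inverse[OF assms]])
  then have sV: "subring V \<R>" by (simp add: valuation_ring_def)
  define Q where "Q = {z. z = 0 \<or> inverse z \<notin> V}"
  have "place_ring Q = V" unfolding Q_def by (rule place_ring_nonunits[OF sV])
  with V show ?thesis by (intro that[of Q]) (auto simp: place_iff Q_def)
qed

lemma everywhere_integral_imp_constant:
  assumes "function_field F" "x \<in> integral_away F P" "x \<in> place_ring P"
  shows "x \<in> F"
  using nonconstant_has_pole[OF assms(1), of x] assms(2,3) by (auto simp: integral_away_def)

text \<open>A nonconstant \<open>x\<close> and its inverse have poles at different places, so one lies away from \<open>P\<close>.\<close>
lemma unit_integral_away_imp_constant:
  assumes F: "function_field F" and x: "x \<in> integral_away F P" "inverse x \<in> integral_away F P"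
  shows "x \<in> F"
proof (rule ccontr)
  assume nF: "x \<notin> F"
  have "inverse x \<notin> F"
    using F nF subfield_inverse[of F "inverse x"] by (auto simp: function_field_def)
  with nonconstant_has_pole[OF F nF] nonconstant_has_pole[OF F, of "inverse x"] x show False
    unfolding integral_away_def by (metis (mono_tags, lifting) inverse_inverse_eq mem_Collect_eq)
qed

section \<open>Quadratic extensions of finite fields\<close>

lemma subfield_typeI:
  assumes "1 \<in> S" "\<And>x. x \<in> S \<Longrightarrow> - x \<in> S" "\<And>x. x \<in> S \<Longrightarrow> inverse x \<in> S"
    "\<And>x y. x \<in> S \<Longrightarrow> y \<in> S \<Longrightarrow> x + y \<in> S" "\<And>x y. x \<in> S \<Longrightarrow> y \<in> S \<Longrightarrow> x * y \<in> S"
  shows "subfield S (\<R> :: 'a::field ring)"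
  by (rule field.subfieldI'[OF field_from_type_algebra])
     (use assms in \<open>auto simp: subring_type_iff m_inv_type_ring\<close>)

text \<open>Multiplication by a nonzero \<open>x\<close> permutes the nonzero elements of
  \<open>S\<close>, so all of \<open>S\<close> consists of roots of \<open>X ^ card S - X\<close>,
  and the degree leaves no room for others. This identifies solution sets in \<open>C\<close> with
  explicitly built fields.\<close>

lemma finite_subfield_eq_roots:
  fixes S :: "'a::field set"
  assumes S: "subfield S \<R>" "finite S"
  shows "{x. x ^ card S = x} = S"
proof -
  note R = subring_typeD[OF subfieldE(1)[OF S(1)]]
  have "card {0, 1::'a} \<le> card S"
    by (rule card_mono) (use R S in auto)
  then have c: "card S \<ge> 2" by simp
  have "x ^ card S = x" if x: "x \<in> S" for x
  proof (cases "x = 0")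
    case False
    let ?S = "S - {0}"
    have im: "(\<lambda>y. x * y) ` ?S = ?S"
    proof (rule endo_inj_surj)
      show "(\<lambda>y. x * y) ` ?S \<subseteq> ?S" using R x False by auto
    qed (use S False in \<open>auto intro: inj_onI\<close>)
    have "prod id ?S = prod id ((\<lambda>y. x * y) ` ?S)" by (simp only: im)
    also have "\<dots> = (\<Prod>y\<in>?S. x * y)"
      by (subst prod.reindex) (use False in \<open>auto intro: inj_onI\<close>)
    also have "\<dots> = x ^ card ?S * prod id ?S" by (simp add: prod.distrib)
    finally have "x ^ card ?S = 1" using S(2) by simp
    moreover have "card S = Suc (card ?S)" using S(2) R(1) c by (simp add: card_Diff_singleton)
    ultimately show ?thesis by simp
  qed (use c in simp)
  then have sub: "S \<subseteq> {x. x ^ card S = x}" by auto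
  define f :: "'a poly" where "f = Polynomial.monom 1 (card S) - [:0, 1:]"
  have f: "{x. poly f x = 0} = {x::'a. x ^ card S = x}"
    by (simp add: f_def poly_monom)
  have f0: "f \<noteq> 0"
  proof
    assume "f = 0"
    then have "Polynomial.coeff f (card S) = 0" by simp
    with c show False by (simp add: f_def coeff_pCons split: nat.splits)
  qed
  have "Polynomial.degree f \<le> card S"
    unfolding f_def by (rule degree_diff_le) (use c in \<open>auto simp: degree_monom_le\<close>)
  with card_poly_roots_bound[OF f0] have "card {x::'a. x ^ card S = x} \<le> card S"
    unfolding f by (rule order_trans)
  moreover have "finite {x::'a. x ^ card S = x}" using poly_roots_finite[OF f0] f by simp
  ultimately show ?thesis using card_seteq[OF _ sub] by simp
qed

text \<open>A polynomial with as many roots as its degree passes this on to its divisors: the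
  cofactor \<open>h\<close> accounts for at most \<open>degree h\<close> of the roots.\<close>

lemma dvd_imp_card_roots:
  fixes p f :: "'a::field poly"
  assumes "f \<noteq> 0" "Polynomial.degree f \<le> card {x. poly f x = 0}" "p dvd f"
  shows "Polynomial.degree p \<le> card {x. poly p x = 0}"
proof -
  from assms(3) obtain h where h: "f = p * h" ..
  have "Polynomial.degree f \<le> card ({x. poly p x = 0} \<union> {x. poly h x = 0})"
    using assms(2) by (simp add: h Collect_disj_eq)
  also have "\<dots> \<le> card {x. poly p x = 0} + card {x. poly h x = 0}" by (rule card_Un_le)
  also have "card {x. poly h x = 0} \<le> Polynomial.degree h"
    by (rule card_poly_roots_bound) (use h assms in auto)
  finally show ?thesis using h assms(1) by (simp add: degree_mult_eq)
qed

lemma quadratic_distinct_roots: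
  fixes u t :: "'a::field"
  assumes "2 \<le> card {x. poly [:u, - t, 1:] x = 0}"
  obtains a b where "a \<noteq> b" "a + b = t" "a * b = u"
proof -
  from assms obtain a b where ab: "a \<noteq> b" "poly [:u, - t, 1:] a = 0" "poly [:u, - t, 1:] b = 0"
    by (auto simp: card_le_Suc_iff numeral_2_eq_2)
  have eq: "u + a * a = a * t" "u + b * b = b * t" using ab(2,3) by (simp_all add: algebra_simps)
  have "(a - b) * (a + b - t) = (u + a * a - a * t) - (u + b * b - b * t)" by (simp add: algebra_simps)
  also have "\<dots> = 0" by (simp add: eq)
  finally have "(a - b) * (a + b - t) = 0" .
  with ab(1) have "a + b = t" by simp
  moreover have "a * b = u" using ab(2) by (simp add: calculation[symmetric] algebra_simps)
  ultimately show ?thesis using ab(1) that by blast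
qed

lemma split_quadratic_dvd_iff:
  fixes a b :: "'a::field"
  assumes "a \<noteq> b"
  shows "[:a * b, - (a + b), 1:] dvd f \<longleftrightarrow> poly f a = 0 \<and> poly f b = 0"
proof -
  have e: "[:a * b, - (a + b), 1:] = [:- a, 1:] * [:- b, 1:]" by (simp add: algebra_simps)
  show ?thesis
  proof
    assume "[:a * b, - (a + b), 1:] dvd f"
    then obtain k where "f = [:- a, 1:] * [:- b, 1:] * k" unfolding e ..
    then have "poly f x = (x - a) * (x - b) * poly k x" for x by (simp only: poly_mult) simp
    then show "poly f a = 0 \<and> poly f b = 0" by simp
  next
    assume f: "poly f a = 0 \<and> poly f b = 0"
    then have "[:- a, 1:] dvd f" by (simp add: poly_eq_0_iff_dvd)
    then obtain h where h: "f = [:- a, 1:] * h" ..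
    with f assms have "poly h b = 0" by simp
    then have "[:- b, 1:] dvd h" by (simp add: poly_eq_0_iff_dvd)
    then show "[:a * b, - (a + b), 1:] dvd f" unfolding e h by (rule mult_dvd_mono[OF dvd_refl])
  qed
qed

section \<open>The embedding of \<open>K\<close> and quadratic extensions inside
  \<open>C\<close>\<close>

locale field_embedding =
  fixes \<iota> :: "'k::field \<Rightarrow> 'c::field"
  assumes embedding: "\<iota> \<in> ring_hom \<R> \<R>"
begin

lemma \<iota>_simps [simp]: "\<iota> (x + y) = \<iota> x + \<iota> y" "\<iota> (x * y) = \<iota> x * \<iota> y" "\<iota> 1 = 1"
  using embedding by (auto simp: ring_hom_def)

lemma \<iota>_0 [simp]: "\<iota> 0 = 0"
  using \<iota>_simps(1)[of 0 0] by (metis add.right_neutral add_left_cancel)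

lemma \<iota>_uminus [simp]: "\<iota> (- x) = - \<iota> x"
  using \<iota>_simps(1)[of x "- x"] by (simp add: eq_neg_iff_add_eq_0 add.commute)

lemma \<iota>_diff [simp]: "\<iota> (x - y) = \<iota> x - \<iota> y"
  using \<iota>_simps(1)[of x "- y"] by simp

lemma \<iota>_eq_0_iff [simp]: "\<iota> x = 0 \<longleftrightarrow> x = 0"
proof
  assume "\<iota> x = 0"
  then have "\<iota> (x * inverse x) = 0" by simp
  then show "x = 0" by (metis \<iota>_simps(3) right_inverse zero_neq_one)
qed simp

lemma \<iota>_eq_iff [simp]: "\<iota> x = \<iota> y \<longleftrightarrow> x = y"
  using \<iota>_eq_0_iff[of "x - y"] by (simp del: \<iota>_eq_0_iff)

lemma \<iota>_inverse [simp]: "\<iota> (inverse x) = inverse (\<iota> x)"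
proof (cases "x = 0")
  case False
  then have "\<iota> x * \<iota> (inverse x) = 1" by (simp flip: \<iota>_simps)
  then show ?thesis by (simp add: inverse_unique)
qed simp

lemma \<iota>_divide [simp]: "\<iota> (x / y) = \<iota> x / \<iota> y"
  by (simp add: divide_inverse)

lemma \<iota>_power [simp]: "\<iota> (x ^ n) = \<iota> x ^ n"
  by (induction n) auto

lemma inj_\<iota>: "inj_on \<iota> F"
  by (auto intro: inj_onI)

lemma linear_eq_0_iff:
  assumes "z \<notin> range \<iota>"
  shows "\<iota> a * z + \<iota> b = 0 \<longleftrightarrow> a = 0 \<and> b = 0"
proof
  assume h: "\<iota> a * z + \<iota> b = 0"
  have "a = 0"
  proof (rule ccontr)
    assume "a \<noteq> 0"
    with h have "z = \<iota> (- b / a)" by (simp add: field_simps eq_neg_iff_add_eq_0)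
    with assms show False by blast
  qed
  with h show "a = 0 \<and> b = 0" by simp
qed simp

text \<open>As \<open>z\<close> is irrational, its equation \<open>X\<^sup>2 - s X + p\<close> is
  minimal over \<open>K\<close>, so a form vanishing at \<open>z\<close> is \<open>c\<close> times
  it.\<close>

lemma quadratic_form_factor:
  assumes z: "z \<notin> range \<iota>" "z + z' = \<iota> s" "z * z' = \<iota> p"
    and q: "\<iota> c * z\<^sup>2 + \<iota> e * z + \<iota> f = 0"
  shows "\<iota> c * x\<^sup>2 + \<iota> e * x + \<iota> f = \<iota> c * (x - z) * (x - z')"
proof -
  have z': "z' = \<iota> s - z" using z(2) by (simp add: algebra_simps)
  have z2: "z\<^sup>2 = \<iota> s * z - \<iota> p" unfolding z(3)[symmetric] z' by (simp add: algebra_simps power2_eq_square)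
  have "\<iota> (e + c * s) * z + \<iota> (f - c * p) = 0"
    using q unfolding z2 by (simp add: algebra_simps)
  then have "e + c * s = 0 \<and> f - c * p = 0" by (simp only: linear_eq_0_iff[OF z(1)])
  then have ef: "e = - c * s" "f = c * p" by (simp_all add: eq_neg_iff_add_eq_0)
  have "\<iota> c * x\<^sup>2 + \<iota> e * x + \<iota> f = \<iota> c * (x\<^sup>2 - (z + z') * x + z * z')"
    unfolding ef z(2,3) by (simp add: algebra_simps)
  then show ?thesis by (simp add: algebra_simps power2_eq_square)
qed

text \<open>The span of \<open>1\<close> and \<open>z\<close> over \<open>F\<close>; for an
  irrational root \<open>z\<close> of a monic quadratic over a subfield \<open>F\<close> it is the
  field \<open>F(z)\<close>.\<close>

definition adjoin :: "'k set \<Rightarrow> 'c \<Rightarrow> 'c set" where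
  "adjoin F z = {\<iota> a + \<iota> b * z | a b. a \<in> F \<and> b \<in> F}"

lemma adjoin_inj:
  assumes "z \<notin> range \<iota>" "\<iota> a + \<iota> b * z = \<iota> a' + \<iota> b' * z"
  shows "a = a' \<and> b = b'"
proof -
  have "\<iota> (b - b') * z + \<iota> (a - a') = 0" using assms(2) by (simp add: algebra_simps)
  then have "b - b' = 0 \<and> a - a' = 0" by (simp only: linear_eq_0_iff[OF assms(1)])
  then show ?thesis by simp
qed

lemma card_adjoin:
  assumes "z \<notin> range \<iota>"
  shows "card (adjoin F z) = (card F)\<^sup>2"
proof -
  have e: "adjoin F z = (\<lambda>(a, b). \<iota> a + \<iota> b * z) ` (F \<times> F)"
    by (auto simp: adjoin_def)
  show ?thesis
    unfolding e using adjoin_inj[OF assms]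
    by (subst card_image) (auto intro!: inj_onI simp: card_cartesian_product power2_eq_square)
qed

lemma adjoin_mult:
  assumes "z\<^sup>2 = \<iota> t * z - \<iota> u"
  shows "(\<iota> a + \<iota> b * z) * (\<iota> c + \<iota> d * z) = \<iota> (a * c - b * d * u) + \<iota> (a * d + b * c + b * d * t) * z"
proof -
  have "(\<iota> a + \<iota> b * z) * (\<iota> c + \<iota> d * z) = \<iota> a * \<iota> c + (\<iota> a * \<iota> d + \<iota> b * \<iota> c) * z + \<iota> b * \<iota> d * z\<^sup>2"
    by (simp add: algebra_simps power2_eq_square)
  also have "\<dots> = \<iota> (a * c - b * d * u) + \<iota> (a * d + b * c + b * d * t) * z"
    unfolding assms by (simp add: algebra_simps)
  finally show ?thesis .
qed

lemma subfield_adjoin: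
  assumes F: "subfield F \<R>" and z: "z \<notin> range \<iota>" "z\<^sup>2 = \<iota> t * z - \<iota> u" and tu: "t \<in> F" "u \<in> F"
  shows "subfield (adjoin F z) \<R>"
proof (rule subfield_typeI)
  note R = subring_typeD[OF subfieldE(1)[OF F]]
  have z2: "z * z = \<iota> t * z - \<iota> u" using z(2) by (simp add: power2_eq_square)
  show "1 \<in> adjoin F z"
    unfolding adjoin_def using R(1,2) by (intro CollectI exI[of _ 1] exI[of _ 0]) auto
  fix x assume "x \<in> adjoin F z"
  then obtain a b where x: "x = \<iota> a + \<iota> b * z" "a \<in> F" "b \<in> F" by (auto simp: adjoin_def)
  show "- x \<in> adjoin F z"
    unfolding adjoin_def using R(3) x by (intro CollectI exI[of _ "- a"] exI[of _ "- b"]) auto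
  show "inverse x \<in> adjoin F z"
  proof (cases "x = 0")
    case True
    then show ?thesis
      unfolding adjoin_def using R(1) by (intro CollectI exI[of _ 0]) auto
  next
    case False
    \<comment> \<open>The norm of \<open>a + b z\<close>, whose conjugate is
      \<open>a + b (t - z)\<close>; dividing the conjugate by the norm gives the inverse.\<close>
    define n where "n = a\<^sup>2 + a * b * t + b\<^sup>2 * u"
    have "x * (\<iota> (a + b * t) - \<iota> b * z) = \<iota> a * \<iota> a + \<iota> a * \<iota> b * \<iota> t + \<iota> b * \<iota> b * \<iota> t * z
        - \<iota> b * \<iota> b * (z * z)"
      by (simp add: x algebra_simps)
    also have "\<dots> = \<iota> n" unfolding z2 by (simp add: n_def algebra_simps power2_eq_square)
    finally have n: "x * (\<iota> (a + b * t) - \<iota> b * z) = \<iota> n" .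
    have "\<iota> (- b) * z + \<iota> (a + b * t) \<noteq> 0"
      using linear_eq_0_iff[OF z(1), of "- b" "a + b * t"] False x by auto
    then have "\<iota> n \<noteq> 0" using n False by auto
    then have "inverse x = (\<iota> (a + b * t) - \<iota> b * z) / \<iota> n"
      using n False by (simp add: field_simps)
    also have "\<dots> = \<iota> ((a + b * t) * inverse n) + \<iota> (- b * inverse n) * z"
      by (simp add: divide_inverse algebra_simps)
    also have "\<dots> \<in> adjoin F z"
    proof -
      have "n \<in> F" unfolding n_def using R x tu by auto
      then have "inverse n \<in> F" by (rule subfield_inverse[OF F])
      then show ?thesis
        unfolding adjoin_def using R x tu
        by (intro CollectI exI[of _ "(a + b * t) * inverse n"] exI[of _ "- b * inverse n"]) auto
    qed
    finally show ?thesis .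
  qed
  fix y assume "y \<in> adjoin F z"
  then obtain c d where y: "y = \<iota> c + \<iota> d * z" "c \<in> F" "d \<in> F" by (auto simp: adjoin_def)
  show "x + y \<in> adjoin F z"
    unfolding adjoin_def using R(5) x y
    by (intro CollectI exI[of _ "a + c"] exI[of _ "b + d"]) (auto simp: algebra_simps)
  have "x * y = \<iota> (a * c - b * d * u) + \<iota> (a * d + b * c + b * d * t) * z"
    unfolding x(1) y(1) by (rule adjoin_mult[OF z(2)])
  also have "\<dots> \<in> adjoin F z"
  proof -
    have "a * c - b * d * u \<in> F" "a * d + b * c + b * d * t \<in> F" using R x y tu by auto
    then show ?thesis unfolding adjoin_def by blast
  qed
  finally show "x * y \<in> adjoin F z" .
qed

lemma subfield_image:
  assumes "subfield F \<R>"
  shows "subfield (\<iota> ` F) \<R>"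
proof (rule subfield_typeI)
  note R = subring_typeD[OF subfieldE(1)[OF assms]]
  show "1 \<in> \<iota> ` F" using R(2) by (metis \<iota>_simps(3) imageI)
  show "- x \<in> \<iota> ` F" if "x \<in> \<iota> ` F" for x using that R(3) by (metis (no_types) \<iota>_uminus image_iff)
  show "inverse x \<in> \<iota> ` F" if "x \<in> \<iota> ` F" for x
    using that subfield_inverse[OF assms] by (metis (no_types) \<iota>_inverse image_iff)
  show "x + y \<in> \<iota> ` F" if "x \<in> \<iota> ` F" "y \<in> \<iota> ` F" for x y
    using that R(5) by (metis (no_types) \<iota>_simps(1) image_iff)
  show "x * y \<in> \<iota> ` F" if "x \<in> \<iota> ` F" "y \<in> \<iota> ` F" for x y
    using that R(4) by (metis (no_types) \<iota>_simps(2) image_iff)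
qed

text \<open>Finite fields are perfect, so an irrational root over a finite field is a simple one.\<close>
lemma conjugate_root_neq:
  assumes F: "subfield F \<R>" "finite F" and z: "z \<notin> range \<iota>" "z\<^sup>2 = \<iota> t * z - \<iota> u" "u \<in> F"
  shows "\<iota> t - z \<noteq> z"
proof
  assume "\<iota> t - z = z"
  moreover have "\<iota> (1 + 1) = 1 + 1" by (simp only: \<iota>_simps)
  ultimately have "\<iota> (1 + 1) * z + \<iota> (- t) = 0" by (simp add: algebra_simps)
  \<comment> \<open>A double root means \<open>2 z = t\<close>, and irrationality of
    \<open>z\<close> leaves only characteristic two with \<open>t = 0\<close>.\<close>
  then have e: "(1 + 1 :: 'k) = 0 \<and> - t = 0" by (simp only: linear_eq_0_iff[OF z(1)])
  note R = subring_typeD[OF subfieldE(1)[OF F(1)]]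
  have "x + x = (1 + 1) * x" for x :: 'k by (simp add: distrib_right del: one_add_one)
  then have "x + x = 0" for x :: 'k using e by simp
  then have 2: "- x = x" for x :: 'k by (metis eq_neg_iff_add_eq_0)
  \<comment> \<open>In characteristic two squaring is injective, hence onto the finite field
    \<open>F\<close>; so \<open>u\<close> is a square and \<open>z\<close> would lie in
    \<open>K\<close>.\<close>
  have "inj_on (\<lambda>x::'k. x\<^sup>2) F"
    using 2 by (auto intro!: inj_onI simp: power2_eq_iff)
  then have "(\<lambda>x. x\<^sup>2) ` F = F"
    by (intro endo_inj_surj F(2)) (auto simp: R)
  with \<open>u \<in> F\<close> obtain v where "u = v\<^sup>2" by blast
  then have "z\<^sup>2 = \<iota> (- (v\<^sup>2))" using z(2) e by simp
  then have "z\<^sup>2 = (\<iota> v)\<^sup>2" by (simp only: 2 \<iota>_power)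
  then have "z = \<iota> v \<or> z = \<iota> (- v)" by (simp add: power2_eq_iff)
  with z(1) show False by blast
qed

text \<open>\<open>adjoin F z\<close> is a subfield with \<open>(card F)\<^sup>2\<close> elements,
  so it is the whole solution set, whichever irrational \<open>z\<close> generates it.\<close>

lemma roots_card_square:
  assumes F: "subfield F \<R>" "finite F"
    and z: "z \<notin> range \<iota>" "z\<^sup>2 = \<iota> t * z - \<iota> u" "t \<in> F" "u \<in> F"
  shows "{x. x ^ ((card F)\<^sup>2) = x} = adjoin F z"
proof -
  have "finite (adjoin F z)"
  proof -
    have "adjoin F z = (\<lambda>(a, b). \<iota> a + \<iota> b * z) ` (F \<times> F)"
      by (auto simp: adjoin_def)
    with F(2) show ?thesis by simp
  qed
  from finite_subfield_eq_roots[OF subfield_adjoin[OF F(1) z] this] show ?thesis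
    by (simp add: card_adjoin[OF z(1)])
qed

lemma roots_card:
  assumes "subfield F \<R>" "finite F"
  shows "{x. x ^ card F = x} = \<iota> ` F"
  using finite_subfield_eq_roots[OF subfield_image[OF assms(1)]] assms(2)
  by (simp add: card_image[OF inj_\<iota>])

end

section \<open>Two by two matrices\<close>

lemma matrix2_eq_iff:
  "M = (N :: 'a^2^2) \<longleftrightarrow>
    M$1$1 = N$1$1 \<and> M$1$2 = N$1$2 \<and> M$2$1 = N$2$1 \<and> M$2$2 = N$2$2"
  by (auto simp: vec_eq_iff forall_2)

lemma matrix2_mult_nth: "((M :: 'a::semiring_1^2^2) ** N) $ i $ j = M$i$1 * N$1$j + M$i$2 * N$2$j"
  by (simp add: matrix_matrix_mult_def sum_2)

lemma mat_nth: "mat k $ i $ j = (if i = j then k else 0)"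
  by (simp add: mat_def)

lemma trace_2: "trace (M :: 'a::comm_semiring_1^2^2) = M$1$1 + M$2$2"
  by (simp add: trace_def sum_2)

lemma scalar_iff:
  "(M :: 'a::semiring_1^2^2) \<in> range mat \<longleftrightarrow> M$1$2 = 0 \<and> M$2$1 = 0 \<and> M$1$1 = M$2$2"
proof
  assume "M$1$2 = 0 \<and> M$2$1 = 0 \<and> M$1$1 = M$2$2"
  then have "M = mat (M$1$1)" by (simp add: matrix2_eq_iff mat_nth)
  then show "M \<in> range mat" by blast
qed (auto simp: mat_nth)

lemma group_GL2:
  assumes "subring A (\<R> :: 'k::field ring)"
  shows "Group.group (GL2 A)"
proof -
  note R = subring_typeD[OF assms]
  have "Group.monoid \<lparr>carrier = {M::'k^2^2. \<forall>i j. M $ i $ j \<in> A}, monoid.mult = (**), one = mat 1\<rparr>"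
    by unfold_locales (auto simp: matrix2_mult_nth mat_nth R matrix_mul_assoc)
  then show ?thesis unfolding GL2_def by (rule monoid.units_group)
qed

lemma GL2_mult [simp]: "M \<otimes>\<^bsub>GL2 A\<^esub> N = M ** N"
  and GL2_one [simp]: "\<one>\<^bsub>GL2 A\<^esub> = mat 1"
  by (simp_all add: GL2_def units_of_def)

lemma in_GL2_iff:
  "M \<in> carrier (GL2 A) \<longleftrightarrow> (\<forall>i j. M$i$j \<in> A) \<and>
     (\<exists>N. (\<forall>i j. N$i$j \<in> A) \<and> N ** M = mat 1 \<and> M ** N = mat 1)"
  by (auto simp: GL2_def units_of_def Units_def)

lemma GL2_det:
  fixes M :: "'k::field^2^2"
  assumes "subring A \<R>" "M \<in> carrier (GL2 A)"
  shows "det M \<noteq> 0" "det M \<in> A" "inverse (det M) \<in> A" "trace M \<in> A"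
proof -
  note R = subring_typeD[OF assms(1)]
  from assms(2) obtain N where N: "\<forall>i j. M$i$j \<in> A" "\<forall>i j. N$i$j \<in> A" "M ** N = mat 1"
    by (auto simp: in_GL2_iff)
  have d: "det M * det N = 1" using N(3) by (metis det_mul det_I)
  then show "det M \<noteq> 0" by auto
  have "det M \<in> A" "det N \<in> A" using N R by (auto simp: det_2)
  with d show "det M \<in> A" "inverse (det M) \<in> A" by (auto simp: inverse_unique)
  show "trace M \<in> A" using N R by (auto simp: trace_2)
qed

context field_embedding
begin

definition charpoly :: "'k^2^2 \<Rightarrow> 'c poly" where
  "charpoly M = [:\<iota> (det M), - \<iota> (trace M), 1:]"

text \<open>By Cayley-Hamilton, the remainder \<open>r X + s\<close> of \<open>X ^ n\<close> modulo the characteristic polynomial computes \<open>M ^ n\<close>.\<close>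
lemma GL2_power:
  "\<exists>r s. (\<forall>i j. (M [^]\<^bsub>GL2 A\<^esub> (n::nat)) $ i $ j = r * M$i$j + (if i = j then s else 0)) \<and>
     charpoly M dvd Polynomial.monom 1 n - [:\<iota> s, \<iota> r:]"
proof (induction n)
  case 0
  show ?case by (rule exI[of _ 0], rule exI[of _ 1]) (auto simp: mat_nth one_pCons)
next
  case (Suc n)
  then obtain r s where rs: "\<And>i j. (M [^]\<^bsub>GL2 A\<^esub> n) $ i $ j = r * M$i$j + (if i = j then s else 0)"
    and dvd: "charpoly M dvd Polynomial.monom 1 n - [:\<iota> s, \<iota> r:]" by auto
  define r' s' where "r' = r * trace M + s" and "s' = - r * det M"
  have m: "\<forall>i j. (M [^]\<^bsub>GL2 A\<^esub> Suc n) $ i $ j = r' * M$i$j + (if i = j then s' else 0)"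
    by (simp add: rs matrix2_mult_nth forall_2 r'_def s'_def trace_2 det_2 algebra_simps)
  have "Polynomial.monom 1 (Suc n) - [:\<iota> s', \<iota> r':] =
      [:0, 1:] * (Polynomial.monom 1 n - [:\<iota> s, \<iota> r:]) + [:\<iota> r:] * charpoly M"
    by (simp add: r'_def s'_def charpoly_def Polynomial.monom_Suc algebra_simps)
  also have "charpoly M dvd \<dots>" by (intro dvd_add dvd_mult dvd dvd_refl)
  finally show ?case using m by blast
qed

text \<open>The identity and a non-scalar \<open>M\<close> are linearly independent, so
  \<open>r M + s = 1\<close> forces \<open>r = 0\<close> and \<open>s = 1\<close>. The
  characteristic polynomial is thus also the minimal one.\<close>

lemma GL2_power_eq_one_iff:
  assumes "M \<notin> range mat"
  shows "M [^]\<^bsub>GL2 A\<^esub> (n::nat) = mat 1 \<longleftrightarrow> charpoly M dvd Polynomial.monom 1 n - 1"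
proof -
  obtain r s where rs: "\<And>i j. (M [^]\<^bsub>GL2 A\<^esub> n) $ i $ j = r * M$i$j + (if i = j then s else 0)"
    and dvd: "charpoly M dvd Polynomial.monom 1 n - [:\<iota> s, \<iota> r:]"
    using GL2_power[where M = M and A = A and n = n] by blast
  have "M [^]\<^bsub>GL2 A\<^esub> n = mat 1 \<longleftrightarrow> r = 0 \<and> s = 1"
  proof
    assume "M [^]\<^bsub>GL2 A\<^esub> n = mat 1"
    then have e: "r * M$1$2 = 0" "r * M$2$1 = 0" "r * M$1$1 + s = 1" "r * M$2$2 + s = 1"
      by (simp_all add: matrix2_eq_iff rs mat_nth)
    have "r = 0"
    proof (rule ccontr)
      assume r: "r \<noteq> 0"
      have "r * M$1$1 = r * M$2$2" using e(3,4) by (metis add_right_cancel)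
      with r e(1,2) assms show False by (simp add: scalar_iff)
    qed
    with e show "r = 0 \<and> s = 1" by simp
  qed (simp add: matrix2_eq_iff rs mat_nth)
  also have "\<dots> \<longleftrightarrow> [:\<iota> s, \<iota> r:] = 1"
    using \<iota>_eq_iff[of s 1] by (simp add: one_pCons conj_commute)
  also have "\<dots> \<longleftrightarrow> charpoly M dvd [:\<iota> s, \<iota> r:] - 1"
  proof
    assume d: "charpoly M dvd [:\<iota> s, \<iota> r:] - 1"
    show "[:\<iota> s, \<iota> r:] = 1"
    proof (rule ccontr)
      assume "[:\<iota> s, \<iota> r:] \<noteq> 1"
      then have "[:\<iota> s, \<iota> r:] - 1 \<noteq> 0" by simp
      from dvd_imp_degree_le[OF d this] show False
        by (simp add: charpoly_def one_pCons split: if_splits)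
    qed
  qed simp
  also have "[:\<iota> s, \<iota> r:] - 1 = (Polynomial.monom 1 n - 1) - (Polynomial.monom 1 n - [:\<iota> s, \<iota> r:])"
    by simp
  also have "charpoly M dvd \<dots> \<longleftrightarrow> charpoly M dvd Polynomial.monom 1 n - 1"
    by (rule dvd_diff_left_iff[OF dvd])
  finally show ?thesis .
qed

section \<open>Fixed points of Moebius transformations\<close>

lemma moebius_fixes_iff:
  assumes "z \<notin> range \<iota>" "det M \<noteq> 0"
  shows "moebius_map \<iota> M z = z \<longleftrightarrow>
    \<iota> (M$2$1) * z\<^sup>2 + \<iota> (M$2$2 - M$1$1) * z + \<iota> (- M$1$2) = 0"
proof -
  have "\<iota> (M$2$1) * z + \<iota> (M$2$2) \<noteq> 0"
    using assms(2) by (auto simp: linear_eq_0_iff[OF assms(1)] det_2)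
  then have "moebius_map \<iota> M z = z \<longleftrightarrow>
    \<iota> (M$1$1) * z + \<iota> (M$1$2) = z * (\<iota> (M$2$1) * z + \<iota> (M$2$2))"
    by (simp add: moebius_map_def divide_eq_eq)
  also have "\<dots> \<longleftrightarrow> \<iota> (M$2$1) * z\<^sup>2 + \<iota> (M$2$2 - M$1$1) * z + \<iota> (- M$1$2) = 0"
    by (auto simp: algebra_simps power2_eq_square)
  finally show ?thesis .
qed

lemma moebius_fixes_imp_lower_nonzero:
  assumes "z \<notin> range \<iota>" "det M \<noteq> 0" "moebius_map \<iota> M z = z" "M \<notin> range mat"
  shows "M$2$1 \<noteq> 0"
proof
  assume c: "M$2$1 = 0"
  then have "\<iota> (M$2$2 - M$1$1) * z + \<iota> (- M$1$2) = 0"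
    using assms(3) by (simp add: moebius_fixes_iff[OF assms(1,2)])
  then have "M$2$2 - M$1$1 = 0 \<and> - M$1$2 = 0" by (simp only: linear_eq_0_iff[OF assms(1)])
  with c assms(4) show False by (simp add: scalar_iff)
qed

text \<open>
  Quadratic forms over \<open>K\<close> with a common irrational zero are proportional, which for the forms
  attached to two matrices means that the matrices commute.
\<close>
lemma moebius_fixes_iff_commutes:
  assumes z: "z \<notin> range \<iota>" and M: "det M \<noteq> 0" "moebius_map \<iota> M z = z" "M \<notin> range mat"
    and N: "det N \<noteq> 0"
  shows "moebius_map \<iota> N z = z \<longleftrightarrow> M ** N = N ** M"
proof -
  define c e f where "c = M$2$1" and "e = M$2$2 - M$1$1" and "f = - M$1$2"
  define c' e' f' where "c' = N$2$1" and "e' = N$2$2 - N$1$1" and "f' = - N$1$2"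
  have c0: "c \<noteq> 0" unfolding c_def by (rule moebius_fixes_imp_lower_nonzero[OF z M])
  have q: "\<iota> c * z\<^sup>2 + \<iota> e * z + \<iota> f = 0"
    using M(2) by (simp only: moebius_fixes_iff[OF z M(1)] c_def e_def f_def)
  have "moebius_map \<iota> N z = z \<longleftrightarrow> \<iota> c' * z\<^sup>2 + \<iota> e' * z + \<iota> f' = 0"
    by (simp only: moebius_fixes_iff[OF z N] c'_def e'_def f'_def)
  \<comment> \<open>Scaling by \<open>c\<close> allows the \<open>z\<^sup>2\<close> term to be
    removed with the equation of \<open>M\<close>, leaving a linear relation whose coefficients must
    vanish.\<close>
  also have "\<dots> \<longleftrightarrow> \<iota> c * (\<iota> c' * z\<^sup>2 + \<iota> e' * z + \<iota> f') = 0"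
    using c0 by simp
  also have "\<iota> c * (\<iota> c' * z\<^sup>2 + \<iota> e' * z + \<iota> f') =
      \<iota> c' * (\<iota> c * z\<^sup>2 + \<iota> e * z + \<iota> f) + (\<iota> (c * e' - c' * e) * z + \<iota> (c * f' - c' * f))"
    by (simp add: algebra_simps)
  also have "\<dots> = \<iota> (c * e' - c' * e) * z + \<iota> (c * f' - c' * f)" unfolding q by simp
  also have "\<dots> = 0 \<longleftrightarrow> c * e' - c' * e = 0 \<and> c * f' - c' * f = 0"
    by (rule linear_eq_0_iff[OF z])
  also have "\<dots> \<longleftrightarrow> M ** N = N ** M"
  proof -
    \<comment> \<open>Up to sign the entries of the commutator are the minors of the two coefficient
      triples; the third minor follows from the other two since \<open>c \<noteq> 0\<close>.\<close>
    have "(M ** N)$1$1 - (N ** M)$1$1 = c * f' - c' * f"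
      "(M ** N)$1$2 - (N ** M)$1$2 = - (f * e' - f' * e)"
      "(M ** N)$2$1 - (N ** M)$2$1 = - (c * e' - c' * e)"
      "(M ** N)$2$2 - (N ** M)$2$2 = - (c * f' - c' * f)"
      by (simp_all add: matrix2_mult_nth c_def e_def f_def c'_def e'_def f'_def algebra_simps)
    then have comm: "M ** N = N ** M \<longleftrightarrow>
        c * e' - c' * e = 0 \<and> c * f' - c' * f = 0 \<and> f * e' - f' * e = 0"
      unfolding matrix2_eq_iff by (metis eq_iff_diff_eq_0 neg_equal_0_iff_equal)
    show ?thesis
    proof
      assume h: "c * e' - c' * e = 0 \<and> c * f' - c' * f = 0"
      have "c * (f * e' - f' * e) = f * (c * e' - c' * e) - e * (c * f' - c' * f)"
        by (simp add: algebra_simps)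
      also have "\<dots> = 0" using h by simp
      finally have "c * (f * e' - f' * e) = 0" .
      with c0 have "f * e' - f' * e = 0" by simp
      with h show "M ** N = N ** M" by (simp add: comm)
    qed (simp add: comm)
  qed
  finally show ?thesis .
qed

text \<open>A fixed point \<open>z\<close> makes \<open>(z, 1)\<close> an eigenvector, with the
  denominator \<open>l\<close> of the Moebius map as eigenvalue. Multiplying the fixed point
  equation by the lower left entry gives the characteristic equation of \<open>l\<close>.\<close>

lemma charpoly_root_of_fixed_point:
  assumes "moebius_map \<iota> M z = z" "z \<notin> range \<iota>" "det M \<noteq> 0"
  defines "l \<equiv> \<iota> (M$2$1) * z + \<iota> (M$2$2)"
  shows "l\<^sup>2 = \<iota> (trace M) * l - \<iota> (det M)"
proof -
  have "\<iota> (M$2$1) * z\<^sup>2 + \<iota> (M$2$2 - M$1$1) * z + \<iota> (- M$1$2) = 0"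
    using assms(1) by (simp only: moebius_fixes_iff[OF assms(2,3)])
  then have "\<iota> (M$2$1) * (\<iota> (M$2$1) * z\<^sup>2 + \<iota> (M$2$2 - M$1$1) * z + \<iota> (- M$1$2)) = 0"
    by simp
  then show ?thesis
    unfolding l_def by (simp add: trace_2 det_2 algebra_simps power2_eq_square)
qed

text \<open>The column \<open>(l - d, c)\<close> is an eigenvector for \<open>l\<close>.\<close>
lemma fixed_point_of_charpoly_root:
  assumes "l\<^sup>2 = \<iota> (trace M) * l - \<iota> (det M)" "M$2$1 \<noteq> 0" "det M \<noteq> 0"
  defines "z \<equiv> (l - \<iota> (M$2$2)) / \<iota> (M$2$1)"
  assumes "z \<notin> range \<iota>"
  shows "moebius_map \<iota> M z = z"
proof -
  have l: "l = \<iota> (M$2$1) * z + \<iota> (M$2$2)" using assms(2) by (simp add: z_def)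
  have "\<iota> (M$2$1) * (\<iota> (M$2$1) * z\<^sup>2 + \<iota> (M$2$2 - M$1$1) * z + \<iota> (- M$1$2)) =
     l\<^sup>2 - (\<iota> (trace M) * l - \<iota> (det M))"
    unfolding l by (simp add: trace_2 det_2 algebra_simps power2_eq_square)
  also have "\<dots> = 0" using assms(1) by simp
  finally show ?thesis using assms(2) by (simp add: moebius_fixes_iff[OF assms(5,3)])
qed

end

section \<open>Absolute values\<close>

sublocale place_completion \<subseteq> field_embedding \<iota>
  by unfold_locales (rule embedding)

context place_completion
begin

abbreviation absv :: "'c \<Rightarrow> real" where "absv x \<equiv> dist x 0"

lemma absv_1 [simp]: "absv 1 = 1"
proof -
  have "absv 1 = absv 1 * absv 1" using abs_mult[of 1 1] by simp
  then show ?thesis by simp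
qed

lemma absv_minus [simp]: "absv (- x) = absv x"
proof -
  have "absv (- 1) * absv (- 1) = 1" using abs_mult[of "- 1" "- 1"] by simp
  then have "absv (- 1) = 1"
    using zero_le_dist[of "- 1 :: 'c" 0] by (simp add: square_eq_1_iff)
  then show ?thesis using abs_mult[of "- 1" x] by simp
qed

lemma absv_inverse: "absv (inverse x) = inverse (absv x)"
proof (cases "x = 0")
  case False
  then have "absv x * absv (inverse x) = 1" using abs_mult[of x "inverse x"] by simp
  then show ?thesis by (rule inverse_unique[symmetric])
qed simp

lemma absv_divide: "absv (x / y) = absv x / absv y"
  by (simp add: divide_inverse abs_mult absv_inverse)

lemma absv_diff_le: "absv (x - y) \<le> max (absv x) (absv y)"
  using abs_ultrametric[of x "- y"] by simp

lemma absv_eq_of_close: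
  assumes "absv (x - y) < absv x"
  shows "absv y = absv x"
proof (rule antisym)
  show "absv y \<le> absv x" using absv_diff_le[of x "x - y"] assms by simp
  show "absv x \<le> absv y" using abs_ultrametric[of "x - y" y] assms by simp
qed

lemma K_inf_approachable:
  "z \<in> K_inf \<iota> \<longleftrightarrow> (\<forall>e>0. \<exists>k. absv (z - \<iota> k) < e)"
proof -
  have "dist (\<iota> k) z = absv (z - \<iota> k)" for k by (metis dist_commute dist_diff)
  then show ?thesis unfolding K_inf_def closure_approachable bex_simps by simp
qed

lemma range_subset_K_inf: "range \<iota> \<subseteq> K_inf \<iota>"
  unfolding K_inf_def by (rule closure_subset)

text \<open>A fixed point \<open>z\<close> and its eigenvalue \<open>c z + d\<close> are related by
  an affine map over \<open>K\<close>, so stability under such maps transfers membership in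
  \<open>K_inf\<close> between them.\<close>

lemma K_inf_affine:
  assumes "z \<in> K_inf \<iota>"
  shows "\<iota> a * z + \<iota> b \<in> K_inf \<iota>"
  unfolding K_inf_approachable
proof (intro allI impI)
  fix e :: real assume e: "e > 0"
  \<comment> \<open>The summand \<open>1\<close> keeps the denominator positive when
    \<open>a = 0\<close>.\<close>
  define d where "d = e / (absv (\<iota> a) + 1)"
  have "d > 0" unfolding d_def using e by (intro divide_pos_pos) (auto intro: add_nonneg_pos)
  then obtain k where k: "absv (z - \<iota> k) < d" using assms by (auto simp: K_inf_approachable)
  have "absv (\<iota> a * z + \<iota> b - \<iota> (a * k + b)) = absv (\<iota> a * (z - \<iota> k))"
    by (simp add: algebra_simps)
  also have "\<dots> = absv (\<iota> a) * absv (z - \<iota> k)" by (rule abs_mult)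
  also have "\<dots> \<le> absv (\<iota> a) * d" using k by (intro mult_left_mono) auto
  also have "\<dots> < e"
  proof -
    have "0 < absv (\<iota> a) + 1" by (simp add: add_nonneg_pos)
    moreover have "absv (\<iota> a) * e < e * (absv (\<iota> a) + 1)" using e by (simp add: algebra_simps)
    ultimately show ?thesis unfolding d_def by (simp only: times_divide_eq_right pos_divide_less_eq)
  qed
  finally show "\<exists>k. absv (\<iota> a * z + \<iota> b - \<iota> k) < e" by blast
qed

lemma K_inf_affine_iff:
  assumes "a \<noteq> 0"
  shows "\<iota> a * z + \<iota> b \<in> K_inf \<iota> \<longleftrightarrow> z \<in> K_inf \<iota>"
proof
  assume "\<iota> a * z + \<iota> b \<in> K_inf \<iota>"
  then have "\<iota> (1 / a) * (\<iota> a * z + \<iota> b) + \<iota> (- b / a) \<in> K_inf \<iota>"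
    using K_inf_affine by blast
  also have "\<iota> (1 / a) * (\<iota> a * z + \<iota> b) + \<iota> (- b / a) = z"
    using assms by (simp add: field_simps)
  finally show "z \<in> K_inf \<iota>" .
qed (rule K_inf_affine)

text \<open>
  If the two roots of \<open>X\<^sup>2 - t X + u\<close> have different absolute values, the larger one is the limit of
  the iteration \<open>x \<mapsto> t - u / x\<close> in \<open>K\<close>.
\<close>
lemma dominant_root_in_K_inf:
  assumes tu: "z + z' = \<iota> t" "z * z' = \<iota> u" and u: "absv (\<iota> u) = 1" and z: "absv z > 1"
  shows "z \<in> K_inf \<iota>"
proof -
  \<comment> \<open>As the product of the roots has absolute value one, \<open>r\<close> is the
    absolute value of the smaller root \<open>z'\<close>.\<close>
  define r where "r = 1 / absv z"
  have r: "0 < r" "r < 1" using z by (auto simp: r_def divide_less_eq)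
  have z0: "z \<noteq> 0" using z by auto
  have "absv z * absv z' = 1" using u tu(2) abs_mult by metis
  then have z': "absv z' = r" by (simp add: r_def divide_inverse inverse_unique)
  define x where "x = rec_nat t (\<lambda>_ y. t - u / y)"
  have x: "x 0 = t" "\<And>n. x (Suc n) = t - u / x n" by (auto simp: x_def)
  have main: "absv (z - \<iota> (x n)) \<le> r ^ Suc n" for n
  proof (induction n)
    case 0
    have "z - \<iota> t = - z'" by (simp flip: tu(1))
    with z' show ?case by (simp add: x(1) del: \<iota>_simps)
  next
    case (Suc n)
    \<comment> \<open>The error stays below \<open>absv z\<close>, so by the ultrametric inequality
      \<open>x n\<close> keeps the absolute value of \<open>z\<close> and may be divided by.\<close>
    have "r ^ Suc n \<le> 1" using r by (intro power_le_one) auto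
    then have "absv (\<iota> (x n)) = absv z"
      using Suc z by (intro absv_eq_of_close) linarith
    then have xn: "absv (\<iota> (x n)) = 1 / r" using r by (simp add: r_def)
    then have x0: "\<iota> (x n) \<noteq> 0" using r by auto
    \<comment> \<open>\<open>z\<close> is a fixed point of the iteration; taking the difference
      shows that a step multiplies the absolute error by \<open>r\<^sup>2\<close>.\<close>
    have "z = \<iota> t - \<iota> u / z" using z0 tu by (simp add: field_simps flip: tu)
    then have "z - \<iota> (x (Suc n)) = \<iota> u / \<iota> (x n) - \<iota> u / z" by (simp add: x(2) algebra_simps)
    also have "\<dots> = \<iota> u * (z - \<iota> (x n)) / (\<iota> (x n) * z)"
      using z0 x0 by (simp add: field_simps)
    finally have "absv (z - \<iota> (x (Suc n))) = absv (z - \<iota> (x n)) * (r * r)"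
      using r by (simp add: absv_divide abs_mult u xn) (simp add: r_def field_simps)
    also have "\<dots> \<le> r ^ Suc n * (r * r)" using Suc r by (intro mult_right_mono) auto
    also have "\<dots> \<le> r ^ Suc n * (r * 1)" using r by (intro mult_left_mono) auto
    finally show ?case by (simp add: mult_ac)
  qed
  show ?thesis
    unfolding K_inf_approachable
  proof (intro allI impI)
    fix e :: real assume "e > 0"
    then obtain n where n: "r ^ n < e" using real_arch_pow_inv[of e r] r by auto
    have "r ^ Suc n \<le> r ^ n" using r by (simp add: mult_left_le_one_le)
    with main[of n] n show "\<exists>k. absv (z - \<iota> k) < e"
      by (intro exI[of _ "x n"]) linarith
  qed
qed

end

section \<open>Elliptic points\<close>

locale drinfeld_half_plane = place_completion P \<iota>
  for P :: "'k::field set" and \<iota> :: "'k \<Rightarrow> 'c::{field, complete_space}" +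
  fixes F :: "'k set"
  assumes function_field: "function_field F" and place: "place F P"
begin

abbreviation A :: "'k set" where "A \<equiv> integral_away F P"
abbreviation G :: "('k^2^2) monoid" where "G \<equiv> GL2 A"
abbreviation stab :: "'c \<Rightarrow> ('k^2^2) set" where "stab \<equiv> stabilizer G (moebius_map \<iota>)"
abbreviation ell :: "'c set" where "ell \<equiv> elliptic_points \<iota> G"

lemma F: "subfield F \<R>" "finite F"
  using function_field by (auto simp: function_field_def)

lemma group_G: "Group.group G"
  by (rule group_GL2[OF subring_integral_away])

lemmas det_G = GL2_det[OF subring_integral_away[of F P]]

lemma det_in_F: "M \<in> carrier G \<Longrightarrow> det M \<in> F"
  using unit_integral_away_imp_constant[OF function_field] det_G by blast

lemma absv_constant:
  assumes "a \<in> F" "a \<noteq> 0"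
  shows "absv (\<iota> a) = 1"
proof -
  have "a \<in> place_ring P" "inverse a \<in> place_ring P"
    using place_subringD(2)[OF place] assms(1) subfield_inverse[OF F(1)] by auto
  then have "absv (\<iota> a) \<le> 1" "absv (\<iota> (inverse a)) \<le> 1" by (simp_all only: abs_place)
  moreover have "absv (\<iota> a) > 0" using assms(2) by simp
  ultimately show ?thesis by (simp add: absv_inverse inverse_le_1_iff)
qed

lemma in_stab_iff: "M \<in> stab z \<longleftrightarrow> M \<in> carrier G \<and> moebius_map \<iota> M z = z"
  by (simp add: stabilizer_def)

lemma in_ell_iff: "z \<in> ell \<longleftrightarrow> z \<notin> K_inf \<iota> \<and> (\<exists>M\<in>stab z. M \<notin> range mat)"
  by (simp add: elliptic_points_def upper_half_plane_def)

lemma stab_eq_centralizer: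
  assumes "z \<notin> K_inf \<iota>" "M \<in> stab z" "M \<notin> range mat"
  shows "stab z = {N \<in> carrier G. M ** N = N ** M}"
proof -
  have z: "z \<notin> range \<iota>" using assms(1) range_subset_K_inf by blast
  have "det M \<noteq> 0" "moebius_map \<iota> M z = z" using assms(2) det_G(1) by (simp_all add: in_stab_iff)
  from moebius_fixes_iff_commutes[OF z this assms(3)] det_G(1) show ?thesis
    by (auto simp: in_stab_iff)
qed

text \<open>
  The two eigenvalues \<open>l\<close> and \<open>trace M - l\<close> lie outside \<open>K\<^sub>\<infinity>\<close>, so neither dominates the other; as
  their product is a constant, the trace is integral at \<open>P\<close> and hence everywhere.
\<close>
lemma eigenvalue:
  assumes "z \<notin> K_inf \<iota>" "M \<in> stab z" "M \<notin> range mat"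
  defines "l \<equiv> \<iota> (M$2$1) * z + \<iota> (M$2$2)"
  shows "M$2$1 \<noteq> 0" "l \<notin> K_inf \<iota>" "l\<^sup>2 = \<iota> (trace M) * l - \<iota> (det M)" "trace M \<in> F"
proof -
  have z: "z \<notin> range \<iota>" using assms(1) range_subset_K_inf by blast
  have M: "M \<in> carrier G" "det M \<noteq> 0" "moebius_map \<iota> M z = z"
    using assms(2) det_G(1) by (auto simp: in_stab_iff)
  show c: "M$2$1 \<noteq> 0" by (rule moebius_fixes_imp_lower_nonzero[OF z M(2,3) assms(3)])
  show l: "l \<notin> K_inf \<iota>" unfolding l_def using assms(1) by (simp add: K_inf_affine_iff[OF c])
  show l2: "l\<^sup>2 = \<iota> (trace M) * l - \<iota> (det M)"
    unfolding l_def by (rule charpoly_root_of_fixed_point[OF M(3) z M(2)])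
  define l' where "l' = \<iota> (- 1) * l + \<iota> (trace M)"
  have l': "l' \<notin> K_inf \<iota>" unfolding l'_def using l by (subst K_inf_affine_iff) auto
  have sum: "l + l' = \<iota> (trace M)" by (simp add: l'_def)
  have prod: "l * l' = \<iota> (det M)"
    using l2 by (simp add: l'_def power2_eq_square algebra_simps)
  have u: "absv (\<iota> (det M)) = 1" by (rule absv_constant[OF det_in_F[OF M(1)] M(2)])
  have "absv l \<le> 1" using dominant_root_in_K_inf[OF sum prod u] l by fastforce
  moreover have "absv l' \<le> 1"
    using dominant_root_in_K_inf[of l' l, OF _ _ u] sum prod l' by (fastforce simp: ac_simps)
  ultimately have "absv (\<iota> (trace M)) \<le> 1"
    unfolding sum[symmetric] using abs_ultrametric[of l l'] by linarith
  then show "trace M \<in> F"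
    using everywhere_integral_imp_constant[OF function_field] det_G(4)[OF M(1)] abs_place by blast
qed

text \<open>The translation by one, which has no fixed point in \<open>C\<close>. It shows that no
  stabilizer of a point is all of \<open>G\<close>.\<close>

lemma one_one_zero_one_in_G: "(\<chi> i j. if i = 1 \<or> j = 2 then 1 else 0) \<in> carrier G" (is "?T \<in> _")
proof -
  have "0 \<in> A" "1 \<in> A" "- 1 \<in> A" using subring_typeD[OF subring_integral_away] by blast+
  let ?S = "(\<chi> i j. if i = j then 1 else if i = 1 then - 1 else 0) :: 'k^2^2"
  have "?S ** ?T = mat 1" "?T ** ?S = mat 1"
    by (simp_all add: matrix2_eq_iff matrix2_mult_nth mat_nth)
  moreover from \<open>0 \<in> A\<close> \<open>1 \<in> A\<close> \<open>- 1 \<in> A\<close> have "\<forall>i j. ?S$i$j \<in> A" "\<forall>i j. ?T$i$j \<in> A" by simp_all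
  ultimately show ?thesis unfolding in_GL2_iff by blast
qed

lemma stab_neq_carrier: "z \<notin> K_inf \<iota> \<Longrightarrow> stab z \<noteq> carrier G"
proof
  assume z: "z \<notin> K_inf \<iota>" and "stab z = carrier G"
  with one_one_zero_one_in_G have "moebius_map \<iota> (\<chi> i j. if i = 1 \<or> j = 2 then 1 else 0) z = z"
    by (metis in_stab_iff)
  then show False by (simp add: moebius_map_def)
qed

section \<open>Powers of matrices and the field with \<open>q\<^sup>2\<close> elements\<close>

definition q where "q = card F"

lemma q: "q \<ge> 2"
proof -
  have "card {0, 1::'k} \<le> card F"
    by (rule card_mono) (use F(2) subring_typeD(1,2)[OF subfieldE(1)[OF F(1)]] in auto)
  then show ?thesis by (simp add: q_def)
qed

text \<open>The nonzero constants are all the roots of unity in \<open>C\<close> of order dividing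
  \<open>q - 1\<close>, so this exponent detects eigenvalues in \<open>F\<close>.\<close>

lemma constant_iff: "x ^ (q - 1) = 1 \<longleftrightarrow> x \<noteq> 0 \<and> x \<in> \<iota> ` F"
proof -
  have q1: "q = Suc (q - 1)" using q by simp
  have "x \<in> \<iota> ` F \<longleftrightarrow> x ^ q = x" using roots_card[OF F] by (auto simp: q_def)
  also have "\<dots> \<longleftrightarrow> x = 0 \<or> x ^ (q - 1) = 1" by (subst q1) auto
  finally show ?thesis using q by (auto simp: power_0_left)
qed

text \<open>An eigenvalue of an elliptic matrix, generating the quadratic constant field extension.\<close>
definition quadratic_constant :: "'c \<Rightarrow> 'k \<Rightarrow> 'k \<Rightarrow> bool" where
  "quadratic_constant l t u \<longleftrightarrow> l \<notin> K_inf \<iota> \<and> l\<^sup>2 = \<iota> t * l - \<iota> u \<and> t \<in> F \<and> u \<in> F"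

lemma quadratic_constantD:
  assumes "quadratic_constant l t u"
  shows "l \<notin> K_inf \<iota>" "l \<notin> range \<iota>" "l\<^sup>2 = \<iota> t * l - \<iota> u" "t \<in> F" "u \<in> F" "\<iota> t - l \<noteq> l"
    "{x. x ^ (q\<^sup>2) = x} = adjoin F l"
proof -
  show l: "l \<notin> K_inf \<iota>" "l\<^sup>2 = \<iota> t * l - \<iota> u" "t \<in> F" "u \<in> F"
    using assms by (auto simp: quadratic_constant_def)
  then show r: "l \<notin> range \<iota>" using range_subset_K_inf by blast
  show "\<iota> t - l \<noteq> l" by (rule conjugate_root_neq[OF F r l(2,4)])
  show "{x. x ^ (q\<^sup>2) = x} = adjoin F l"
    unfolding q_def by (rule roots_card_square[OF F r l(2-4)])
qed

lemma eigenvalue_quadratic_constant: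
  assumes "z \<notin> K_inf \<iota>" "M \<in> stab z" "M \<notin> range mat"
  shows "quadratic_constant (\<iota> (M$2$1) * z + \<iota> (M$2$2)) (trace M) (det M)"
  using eigenvalue[OF assms] assms(2) det_in_F by (auto simp: quadratic_constant_def in_stab_iff)

lemma charpoly_split:
  assumes "l + l' = \<iota> (trace M)" "l * l' = \<iota> (det M)"
  shows "charpoly M = [:l * l', - (l + l'), 1:]"
  by (simp add: charpoly_def assms)

text \<open>The eigenvalues \<open>l\<close> and \<open>trace M - l\<close> are distinct, so
  \<open>M\<close> has trivial \<open>n\<close>-th power exactly if both of them do. They are
  nonzero elements of \<open>adjoin F l\<close>, which has \<open>q\<^sup>2\<close> elements, while
  \<open>l\<close> is not in \<open>K\<close>.\<close>

lemma elliptic_power: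
  assumes "z \<notin> K_inf \<iota>" "M \<in> stab z" "M \<notin> range mat"
  shows "M [^]\<^bsub>G\<^esub> (q\<^sup>2 - 1) = mat 1" "M [^]\<^bsub>G\<^esub> (q - 1) \<noteq> mat 1"
proof -
  define l where "l = \<iota> (M$2$1) * z + \<iota> (M$2$2)"
  define l' where "l' = \<iota> (trace M) - l"
  note l = quadratic_constantD[OF eigenvalue_quadratic_constant[OF assms], folded l_def]
  note R = subring_typeD[OF subfieldE(1)[OF F(1)]]
  have sum: "l + l' = \<iota> (trace M)" and prod: "l * l' = \<iota> (det M)"
    using l(3) by (simp_all add: l'_def power2_eq_square algebra_simps)
  have dvd: "charpoly M dvd Polynomial.monom 1 n - 1 \<longleftrightarrow> l ^ n = 1 \<and> l' ^ n = 1" for n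
    unfolding charpoly_split[OF sum prod] using l(6)
    by (subst split_quadratic_dvd_iff) (auto simp: l'_def poly_monom)
  have "l = \<iota> 0 + \<iota> 1 * l" "l' = \<iota> (trace M) + \<iota> (- 1) * l" by (simp_all add: l'_def)
  then have "l \<in> adjoin F l" "l' \<in> adjoin F l" unfolding adjoin_def using R l(4) by blast+
  then have ll: "l ^ (q\<^sup>2) = l" "l' ^ (q\<^sup>2) = l'" unfolding l(7)[symmetric] by auto
  have "\<iota> (det M) \<noteq> 0" using assms(2) det_G(1) by (simp add: in_stab_iff)
  then have "l \<noteq> 0" "l' \<noteq> 0" unfolding prod[symmetric] by auto
  moreover have "q\<^sup>2 = Suc (q\<^sup>2 - 1)" using q by simp
  ultimately have "l ^ (q\<^sup>2 - 1) = 1" "l' ^ (q\<^sup>2 - 1) = 1"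
    using ll by (metis mult_cancel_left2 power_Suc mult.commute)+
  then show "M [^]\<^bsub>G\<^esub> (q\<^sup>2 - 1) = mat 1"
    by (simp add: GL2_power_eq_one_iff[OF assms(3)] dvd)
  have "l ^ (q - 1) \<noteq> 1" using l(2) unfolding constant_iff by blast
  then show "M [^]\<^bsub>G\<^esub> (q - 1) \<noteq> mat 1"
    by (simp add: GL2_power_eq_one_iff[OF assms(3)] dvd)
qed

text \<open>
  The characteristic polynomial of \<open>g\<close> divides the separable polynomial \<open>X ^ (q\<^sup>2 - 1) - 1\<close>, which
  splits over the field with \<open>q\<^sup>2\<close> elements; its roots cannot both be constants in \<open>F\<close>.
\<close>
lemma fixed_point_of_power_eq_one:
  assumes l: "quadratic_constant l t u"
    and g: "g \<in> carrier G" "g \<notin> range mat"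
      "g [^]\<^bsub>G\<^esub> (q\<^sup>2 - 1) = mat 1" "g [^]\<^bsub>G\<^esub> (q - 1) \<noteq> mat 1"
  shows "\<exists>w. w \<notin> K_inf \<iota> \<and> g \<in> stab w"
proof -
  note l = quadratic_constantD[OF l]
  define n where "n = q\<^sup>2 - 1"
  have qn: "q\<^sup>2 = Suc n" and "n \<noteq> 0"
  proof -
    have "2\<^sup>2 \<le> q\<^sup>2" using q by (rule power_mono) simp
    then show "q\<^sup>2 = Suc n" "n \<noteq> 0" by (simp_all add: n_def)
  qed
  define f :: "'c poly" where "f = Polynomial.monom 1 n - 1"
  have dvd: "charpoly g dvd f"
    using g(3) unfolding GL2_power_eq_one_iff[OF g(2)] f_def n_def .
  \<comment> \<open>\<open>X f\<close> is \<open>X ^ q\<^sup>2 - X\<close>, so the roots of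
    \<open>f\<close> together with \<open>0\<close> fill \<open>adjoin F l\<close>; this gives
    \<open>f\<close> as many roots as its degree.\<close>
  have "{x. x = 0} \<union> {x. poly f x = 0} = adjoin F l"
    unfolding l(7)[symmetric] qn by (auto simp: f_def poly_monom)
  then have "card (adjoin F l) \<le> card {x::'c. x = 0} + card {x. poly f x = 0}"
    by (metis card_Un_le)
  then have roots: "n \<le> card {x. poly f x = 0}"
    using qn by (simp add: card_adjoin[OF l(2)] flip: q_def)
  have f0: "f \<noteq> 0"
  proof
    assume "f = 0"
    then have "Polynomial.coeff f n = 0" by simp
    with \<open>n \<noteq> 0\<close> show False by (simp add: f_def one_pCons coeff_pCons split: nat.splits)
  qed
  have "Polynomial.degree f \<le> n"
    unfolding f_def by (rule degree_diff_le) (auto simp: degree_monom_le)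
  with roots have "Polynomial.degree f \<le> card {x. poly f x = 0}" by simp
  from dvd_imp_card_roots[OF f0 this dvd] have "2 \<le> card {x. poly (charpoly g) x = 0}"
    by (simp add: charpoly_def)
  then obtain a b where ab: "a \<noteq> b" "a + b = \<iota> (trace g)" "a * b = \<iota> (det g)"
    unfolding charpoly_def by (rule quadratic_distinct_roots)
  have split: "charpoly g dvd h \<longleftrightarrow> poly h a = 0 \<and> poly h b = 0" for h
    unfolding charpoly_split[OF ab(2,3)] by (rule split_quadratic_dvd_iff[OF ab(1)])
  have det: "det g \<noteq> 0" by (rule det_G(1)[OF g(1)])
  have "\<iota> (det g) \<noteq> 0" using det by simp
  then have ab0: "a \<noteq> 0" "b \<noteq> 0" unfolding ab(3)[symmetric] by auto
  have "a ^ n = 1" "b ^ n = 1" using dvd unfolding split by (auto simp: f_def poly_monom)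
  then have "a \<in> {x. x ^ q\<^sup>2 = x}" "b \<in> {x. x ^ q\<^sup>2 = x}" by (simp_all add: qn)
  then have adj: "a \<in> adjoin F l" "b \<in> adjoin F l" by (simp_all only: l(7))
  have "\<not> (a ^ (q - 1) = 1 \<and> b ^ (q - 1) = 1)"
    using g(4) unfolding GL2_power_eq_one_iff[OF g(2)] split by (simp add: poly_monom)
  then have "\<not> (a \<in> \<iota> ` F \<and> b \<in> \<iota> ` F)" using ab0 unfolding constant_iff by blast
  \<comment> \<open>Either eigenvalue may be the one outside \<open>F\<close>, so the argument is
    made for an arbitrary ordering \<open>m\<close>, \<open>m'\<close> of the two.\<close>
  moreover have "\<exists>w. w \<notin> K_inf \<iota> \<and> g \<in> stab w"
    if m: "m \<in> adjoin F l" "m \<notin> \<iota> ` F" "m + m' = \<iota> (trace g)" "m * m' = \<iota> (det g)" for m m'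
  proof -
    from m(1) obtain x y where xy: "m = \<iota> x + \<iota> y * l" "x \<in> F" "y \<in> F"
      by (auto simp: adjoin_def)
    \<comment> \<open>With \<open>y \<noteq> 0\<close>, \<open>m\<close> is a nonconstant affine
      function of \<open>l\<close> over \<open>K\<close>, and
      \<open>l \<notin> K_inf \<iota>\<close> keeps it out of \<open>K_inf\<close>.\<close>
    have "y \<noteq> 0" using m(2) xy by auto
    then have mK: "m \<notin> K_inf \<iota>"
      using K_inf_affine_iff[of y l x] l(1) by (simp add: xy(1) add.commute)
    then have mr: "m \<notin> range \<iota>" using range_subset_K_inf by blast
    have m': "m' = \<iota> (trace g) - m" using m(3) by (simp add: algebra_simps)
    have m2: "m\<^sup>2 = \<iota> (trace g) * m - \<iota> (det g)"
      unfolding m(4)[symmetric] m' by (simp add: power2_eq_square algebra_simps)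
    \<comment> \<open>Otherwise the diagonal entries would be the eigenvalues, putting
      \<open>m\<close> in the image of \<open>K\<close>.\<close>
    have c: "g$2$1 \<noteq> 0"
    proof
      assume "g$2$1 = 0"
      then have "(m - \<iota> (g$1$1)) * (m - \<iota> (g$2$2)) = 0"
        using m2 by (simp add: det_2 trace_2 power2_eq_square algebra_simps)
      with mr show False by auto
    qed
    define w where "w = (m - \<iota> (g$2$2)) / \<iota> (g$2$1)"
    have "m = \<iota> (g$2$1) * w + \<iota> (g$2$2)" using c by (simp add: w_def)
    then have wK: "w \<notin> K_inf \<iota>" using mK K_inf_affine_iff[OF c] by metis
    then have "w \<notin> range \<iota>" using range_subset_K_inf by blast
    then have "moebius_map \<iota> g w = w"
      unfolding w_def by (rule fixed_point_of_charpoly_root[OF m2 c det])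
    with wK g(1) show ?thesis by (auto simp: in_stab_iff)
  qed
  ultimately show ?thesis using adj ab by (metis add.commute mult.commute)
qed

section \<open>Transport of stabilizers by automorphisms\<close>

lemma automorphism_maps_stab:
  assumes \<sigma>: "\<sigma> \<in> carrier (AutoGroup G)" and z: "z \<in> ell"
  shows "\<exists>w\<in>ell. \<sigma> ` stab z = stab w"
proof -
  from z obtain M where zK: "z \<notin> K_inf \<iota>" and M: "M \<in> stab z" "M \<notin> range mat"
    by (auto simp: in_ell_iff)
  have MG: "M \<in> carrier G" using M(1) by (simp add: in_stab_iff)
  have hom: "\<sigma> \<in> hom G G" and bij: "bij_betw \<sigma> (carrier G) (carrier G)"
    using \<sigma> by (auto simp: AutoGroup_def auto_def Bij_def)
  interpret group_hom G G \<sigma>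
    by (intro group_hom.intro group_hom_axioms.intro group_G hom)
  have inj: "\<sigma> x = \<sigma> y \<longleftrightarrow> x = y" if "x \<in> carrier G" "y \<in> carrier G" for x y
    using bij that by (auto simp: bij_betw_def inj_on_def)
  have cent: "\<sigma> ` stab z = {N \<in> carrier G. \<sigma> M ** N = N ** \<sigma> M}"
  proof -
    have "M ** N = N ** M \<longleftrightarrow> \<sigma> M ** \<sigma> N = \<sigma> N ** \<sigma> M" if "N \<in> carrier G" for N
    proof -
      have "\<sigma> (M ** N) = \<sigma> M ** \<sigma> N" "\<sigma> (N ** M) = \<sigma> N ** \<sigma> M"
        using hom_mult[OF MG that] hom_mult[OF that MG] by simp_all
      moreover have "M ** N \<in> carrier G" "N ** M \<in> carrier G"
        using G.m_closed[OF MG that] G.m_closed[OF that MG] by simp_all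
      ultimately show ?thesis using inj by metis
    qed
    then have "stab z = {N \<in> carrier G. \<sigma> M ** \<sigma> N = \<sigma> N ** \<sigma> M}"
      unfolding stab_eq_centralizer[OF zK M] by blast
    moreover have "\<sigma> ` carrier G = carrier G" using bij by (simp add: bij_betw_def)
    ultimately show ?thesis by (auto simp: image_iff)
  qed
  have gG: "\<sigma> M \<in> carrier G" using MG by simp
  \<comment> \<open>A scalar image is central, so \<open>stab z\<close> would be mapped onto all of
    \<open>G\<close> and hence be \<open>G\<close> itself, which the translation by one
    excludes.\<close>
  have ns: "\<sigma> M \<notin> range mat"
  proof
    assume "\<sigma> M \<in> range mat"
    then obtain k where "\<sigma> M = mat k" by blast
    then have "\<sigma> M ** N = N ** \<sigma> M" for N
      by (simp add: matrix2_eq_iff matrix2_mult_nth mat_nth mult.commute)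
    then have "\<sigma> ` stab z = \<sigma> ` carrier G" using cent bij by (simp add: bij_betw_def)
    moreover have "stab z \<subseteq> carrier G" by (auto simp: in_stab_iff)
    ultimately have "stab z = carrier G"
      using bij by (metis bij_betw_def inj_on_image_eq_iff order_refl)
    with stab_neq_carrier[OF zK] show False by simp
  qed
  have pow: "\<sigma> M [^]\<^bsub>G\<^esub> n = mat 1 \<longleftrightarrow> M [^]\<^bsub>G\<^esub> n = mat 1" for n :: nat
  proof -
    have "\<sigma> M [^]\<^bsub>G\<^esub> n = mat 1 \<longleftrightarrow> \<sigma> (M [^]\<^bsub>G\<^esub> n) = \<sigma> \<one>\<^bsub>G\<^esub>"
      using hom_nat_pow[OF MG, of n] hom_one by simp
    also have "\<dots> \<longleftrightarrow> M [^]\<^bsub>G\<^esub> n = \<one>\<^bsub>G\<^esub>"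
      by (rule inj[OF G.nat_pow_closed[OF MG] G.one_closed])
    finally show ?thesis by simp
  qed
  \<comment> \<open>The point \<open>z\<close> itself supplies the quadratic constant that the
    converse requires.\<close>
  obtain w where w: "w \<notin> K_inf \<iota>" "\<sigma> M \<in> stab w"
    using fixed_point_of_power_eq_one[OF eigenvalue_quadratic_constant[OF zK M] gG ns]
      elliptic_power[OF zK M] by (auto simp: pow)
  then have "w \<in> ell" using ns by (auto simp: in_ell_iff)
  moreover have "\<sigma> ` stab z = stab w"
    unfolding cent stab_eq_centralizer[OF w ns] ..
  ultimately show ?thesis by blast
qed

subsection \<open>Conjugation and the action\<close>

text \<open>The field with \<open>q\<^sup>2\<close> elements is \<open>F + F l\<close>, so its
  compositum with \<open>K\<close> is \<open>K + K l\<close>.\<close>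

lemma K_tilde_eq:
  assumes "quadratic_constant l t u"
  shows "K_tilde F \<iota> = adjoin UNIV l"
proof
  note l = quadratic_constantD[OF assms]
  have roots: "{x. x ^ ((card F)\<^sup>2) = x} = adjoin F l" using l(7) by (simp only: q_def)
  have U: "subfield UNIV (\<R> :: 'k ring)" by (rule subfield_typeI) auto
  have "subfield (adjoin UNIV l) \<R>" by (rule subfield_adjoin[OF U l(2,3)]) auto
  moreover have "adjoin F l \<subseteq> adjoin UNIV l" by (auto simp: adjoin_def)
  moreover have "range \<iota> \<subseteq> adjoin UNIV l"
  proof
    fix x assume "x \<in> range \<iota>"
    then obtain a where "x = \<iota> a + \<iota> 0 * l" by auto
    then show "x \<in> adjoin UNIV l" unfolding adjoin_def by blast
  qed
  ultimately show "K_tilde F \<iota> \<subseteq> adjoin UNIV l"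
    unfolding K_tilde_def roots
    by (intro field.generate_field_min_subfield1[OF field_from_type_algebra]) auto
  let ?H = "adjoin F l \<union> range \<iota>"
  note R = subring_typeD[OF subfieldE(1)[OF F(1)]]
  have "l = \<iota> 0 + \<iota> 1 * l" by simp
  then have "l \<in> adjoin F l" unfolding adjoin_def using R(1,2) by blast
  then have gl: "l \<in> generate_field \<R> ?H" by (intro generate_field.incl) simp
  have gi: "\<iota> a \<in> generate_field \<R> ?H" for a by (intro generate_field.incl) simp
  show "adjoin UNIV l \<subseteq> K_tilde F \<iota>"
    unfolding K_tilde_def roots
    using generate_field.eng_add[OF gi generate_field.eng_mult[OF gi gl]] by (auto simp: adjoin_def)
qed

text \<open>\<open>conj_pt\<close> is a definite description, so evaluating it requires both
  constructing the automorphism that exchanges \<open>l\<close> and \<open>t - l\<close> and showing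
  that no other nontrivial one exists.\<close>

lemma conj_pt_eq:
  assumes "quadratic_constant l t u"
  shows "conj_pt F \<iota> (\<iota> a + \<iota> b * l) = \<iota> a + \<iota> b * (\<iota> t - l)"
proof -
  note l = quadratic_constantD[OF assms]
  define l' where "l' = \<iota> t - l"
  have l': "l'\<^sup>2 = \<iota> t * l' - \<iota> u" using l(3) by (simp add: l'_def power2_eq_square algebra_simps)
  let ?E = "adjoin UNIV l"
  define f where "f = (\<lambda>(a, b). \<iota> a + \<iota> b * l)"
  \<comment> \<open>Coordinates in the basis \<open>1\<close>, \<open>l\<close> are unique, so
    \<open>f\<close> can be inverted; the restriction makes \<open>\<tau>\<close> extensional, as
    \<open>Gal\<close> demands.\<close>
  define \<tau> where "\<tau> = (\<lambda>x\<in>?E. case inv_into UNIV f x of (a, b) \<Rightarrow> \<iota> a + \<iota> b * l')"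
  have E: "?E = range f" by (auto simp: adjoin_def f_def)
  have "inj f" using adjoin_inj[OF l(2)] by (auto intro!: injI simp: f_def)
  then have \<tau>_f: "\<tau> (f ab) = (case ab of (a, b) \<Rightarrow> \<iota> a + \<iota> b * l')" for ab
    by (simp add: \<tau>_def E)
  have \<tau>: "\<tau> (\<iota> a + \<iota> b * l) = \<iota> a + \<iota> b * l'" for a b using \<tau>_f[of "(a, b)"] by (simp add: f_def)
  have memE: "\<iota> a + \<iota> b * l \<in> ?E" for a b by (auto simp: adjoin_def)
  have inE: "\<exists>a b. x = \<iota> a + \<iota> b * l" if "x \<in> ?E" for x using that by (auto simp: adjoin_def)
  have swap: "\<iota> a + \<iota> b * l' = \<iota> (a + b * t) + \<iota> (- b) * l" for a b
    by (simp add: l'_def algebra_simps)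
  have \<iota>_form: "\<iota> a = \<iota> a + \<iota> 0 * l" for a by simp
  have clos: "\<tau> x \<in> ?E" "\<tau> (\<tau> x) = x" if "x \<in> ?E" for x
  proof -
    from inE[OF that] obtain a b where x: "x = \<iota> a + \<iota> b * l" by blast
    show "\<tau> x \<in> ?E" unfolding x \<tau> swap by (rule memE)
    show "\<tau> (\<tau> x) = x" unfolding x \<tau> swap by (simp add: algebra_simps)
  qed
  have \<tau>_\<iota>: "\<tau> (\<iota> a) = \<iota> a" for a using \<tau>[of a 0] by simp
  have \<tau>_Gal: "\<tau> \<in> Gal ?E (range \<iota>)"
    unfolding Gal_def
  proof (intro CollectI conjI)
    show "\<tau> \<in> extensional ?E" by (simp add: \<tau>_def)
    show "\<tau> \<in> ring_iso (sub_ring ?E) (sub_ring ?E)"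
      unfolding ring_iso_def
    proof (intro CollectI conjI ring_hom_memI)
      show "bij_betw \<tau> (carrier (sub_ring ?E)) (carrier (sub_ring ?E))"
        by (rule bij_betw_byWitness[of _ \<tau>]) (auto simp: clos)
      fix x assume "x \<in> carrier (sub_ring ?E)"
      then have xE: "x \<in> ?E" by simp
      show "\<tau> x \<in> carrier (sub_ring ?E)" using clos(1)[OF xE] by simp
      fix y assume "y \<in> carrier (sub_ring ?E)"
      then have yE: "y \<in> ?E" by simp
      from inE[OF xE] inE[OF yE] obtain a b c d
        where xy: "x = \<iota> a + \<iota> b * l" "y = \<iota> c + \<iota> d * l" by blast
      \<comment> \<open>\<open>l\<close> and \<open>l'\<close> satisfy the same quadratic equation,
        so the product formula has the same coefficients for both.\<close>
      have "\<tau> (x * y) = \<tau> x * \<tau> y"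
        unfolding xy \<tau> adjoin_mult[OF l(3)] adjoin_mult[OF l'] ..
      then show "\<tau> (x \<otimes>\<^bsub>sub_ring ?E\<^esub> y) = \<tau> x \<otimes>\<^bsub>sub_ring ?E\<^esub> \<tau> y" by simp
      have "x + y = \<iota> (a + c) + \<iota> (b + d) * l" by (simp add: xy algebra_simps)
      then have "\<tau> (x + y) = \<tau> x + \<tau> y" unfolding xy by (simp only: \<tau>) (simp add: algebra_simps)
      then show "\<tau> (x \<oplus>\<^bsub>sub_ring ?E\<^esub> y) = \<tau> x \<oplus>\<^bsub>sub_ring ?E\<^esub> \<tau> y" by simp
    qed (use \<tau>_\<iota>[of 1] in simp)
    show "\<forall>x\<in>range \<iota>. \<tau> x = x" using \<tau>_\<iota> by auto
  qed
  have \<tau>_nontrivial: "\<tau> \<noteq> (\<lambda>x\<in>?E. x)"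
  proof
    assume e: "\<tau> = (\<lambda>x\<in>?E. x)"
    have "l \<in> ?E" using memE[of 0 1] by simp
    then have "\<tau> l = l" unfolding e by simp
    with \<tau>[of 0 1] l(6) show False by (simp add: l'_def)
  qed
  have unique: "\<rho> = \<tau>" if \<rho>: "\<rho> \<in> Gal ?E (range \<iota>)" "\<rho> \<noteq> (\<lambda>x\<in>?E. x)" for \<rho>
  proof -
    have hom: "\<rho> \<in> ring_hom (sub_ring ?E) (sub_ring ?E)" and ext: "\<rho> \<in> extensional ?E"
      and fix_\<iota>: "\<rho> (\<iota> a) = \<iota> a" for a
      using \<rho>(1) by (auto simp: Gal_def ring_iso_def)
    have \<iota>E: "\<iota> a \<in> ?E" for a using memE[of a 0] by simp
    have lE: "l \<in> ?E" using memE[of 0 1] by simp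
    have mlE: "\<iota> b * l \<in> ?E" for b using memE[of 0 b] by simp
    have \<rho>_lin: "\<rho> (\<iota> a + \<iota> b * l) = \<iota> a + \<iota> b * \<rho> l" for a b
      using ring_hom_add[OF hom, of "\<iota> a" "\<iota> b * l"] ring_hom_mult[OF hom, of "\<iota> b" l]
      by (simp add: \<iota>E lE mlE fix_\<iota>)
    have "l * l = \<iota> (- u) + \<iota> t * l" using l(3) by (simp add: power2_eq_square)
    moreover have "\<rho> (l * l) = \<rho> l * \<rho> l" using ring_hom_mult[OF hom, of l l] lE by simp
    ultimately have r2: "\<rho> l * \<rho> l = \<iota> (- u) + \<iota> t * \<rho> l" by (simp only: \<rho>_lin)
    \<comment> \<open>\<open>\<rho> l\<close> is a root of the quadratic with roots \<open>l\<close>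
      and \<open>l'\<close>; fixing \<open>l\<close> would make \<open>\<rho>\<close> the
      identity.\<close>
    have "(\<rho> l - l) * (\<rho> l - l') = \<rho> l * \<rho> l - \<iota> t * \<rho> l + (\<iota> t * l - l\<^sup>2)"
      by (simp add: l'_def algebra_simps power2_eq_square)
    also have "\<dots> = 0" unfolding r2 l(3) by simp
    finally have "\<rho> l = l \<or> \<rho> l = l'" by simp
    moreover have "\<rho> l \<noteq> l"
    proof
      assume "\<rho> l = l"
      then have "\<rho> x = (\<lambda>x\<in>?E. x) x" if "x \<in> ?E" for x using inE[OF that] \<rho>_lin that by auto
      then have "\<rho> = (\<lambda>x\<in>?E. x)" using ext by (intro extensionalityI[of _ ?E]) auto
      with \<rho>(2) show False ..
    qed
    ultimately have "\<rho> l = l'" by blast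
    then have "\<rho> x = \<tau> x" if "x \<in> ?E" for x using inE[OF that] \<rho>_lin \<tau> by auto
    then show ?thesis using ext by (intro extensionalityI[of _ ?E]) (auto simp: \<tau>_def)
  qed
  have "conj_pt F \<iota> = \<tau>"
    unfolding conj_pt_def K_tilde_eq[OF assms]
  proof (rule the_equality)
    show "\<tau> \<in> Gal ?E (range \<iota>) \<and> \<tau> \<noteq> (\<lambda>x\<in>?E. x)"
      using \<tau>_Gal \<tau>_nontrivial by (rule conjI)
    show "\<rho> = \<tau>" if "\<rho> \<in> Gal ?E (range \<iota>) \<and> \<rho> \<noteq> (\<lambda>x\<in>?E. x)" for \<rho>
      by (rule unique[OF conjunct1[OF that] conjunct2[OF that]])
  qed
  then show ?thesis using \<tau> by (simp add: l'_def)
qed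

abbreviation conj :: "'c \<Rightarrow> 'c" where "conj \<equiv> conj_pt F \<iota>"

text \<open>\<open>s\<close> and \<open>p\<close> are the trace and norm of \<open>z\<close> over
  \<open>K\<close>. As \<open>l = c z + d\<close> with \<open>c \<noteq> 0\<close>, \<open>z\<close>
  lies in \<open>K + K l\<close> and its conjugate is computed from that of
  \<open>l\<close>.\<close>

lemma conj_elliptic:
  assumes "z \<in> ell"
  obtains s p where "z + conj z = \<iota> s" "z * conj z = \<iota> p" "conj (conj z) = z"
proof -
  from assms obtain M where zK: "z \<notin> K_inf \<iota>" and M: "M \<in> stab z" "M \<notin> range mat"
    by (auto simp: in_ell_iff)
  define c d t u where "c = M$2$1" and "d = M$2$2" and "t = trace M" and "u = det M"
  define l where "l = \<iota> c * z + \<iota> d"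
  have l: "quadratic_constant l t u"
    using eigenvalue_quadratic_constant[OF zK M] by (simp only: l_def c_def d_def t_def u_def)
  note lD = quadratic_constantD[OF l]
  have c: "c \<noteq> 0" unfolding c_def by (rule eigenvalue(1)[OF zK M])
  define a b where "a = - d / c" and "b = 1 / c"
  have z: "z = \<iota> a + \<iota> b * l" using c by (simp add: l_def a_def b_def field_simps)
  have cz: "conj z = \<iota> a + \<iota> b * (\<iota> t - l)" unfolding z by (rule conj_pt_eq[OF l])
  also have "\<dots> = \<iota> (a + b * t) + \<iota> (- b) * l" by (simp add: algebra_simps)
  finally have "conj (conj z) = \<iota> (a + b * t) + \<iota> (- b) * (\<iota> t - l)"
    by (simp only: conj_pt_eq[OF l])
  also have "\<dots> = z" unfolding z by (simp add: algebra_simps)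
  finally have "conj (conj z) = z" .
  moreover have "z + conj z = \<iota> (2 * a + b * t)"
  proof -
    have "z + conj z = (\<iota> a + \<iota> a) + \<iota> b * \<iota> t" unfolding cz by (simp add: z algebra_simps)
    then show ?thesis by (simp only: \<iota>_simps mult_2)
  qed
  moreover have "z * conj z = \<iota> (a * a + a * b * t + b * b * u)"
  proof -
    have "z * conj z = \<iota> a * \<iota> a + \<iota> a * \<iota> b * \<iota> t + \<iota> b * \<iota> b * (\<iota> t * l - l\<^sup>2)"
      unfolding cz by (simp add: z algebra_simps power2_eq_square)
    also have "\<iota> t * l - l\<^sup>2 = \<iota> u" unfolding lD(3) by simp
    finally show ?thesis by simp
  qed
  ultimately show ?thesis using that by blast
qed

text \<open>The form whose zeros are the fixed points of \<open>N\<close> vanishes at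
  \<open>z\<close>, so it is a multiple of \<open>(x - z) (x - z')\<close> and vanishes at
  \<open>z'\<close> too.\<close>

lemma stab_subset_conjugate:
  assumes "z \<notin> range \<iota>" "z' \<notin> range \<iota>" "z + z' = \<iota> s" "z * z' = \<iota> p"
  shows "stab z \<subseteq> stab z'"
proof
  fix N assume N: "N \<in> stab z"
  then have NG: "N \<in> carrier G" "det N \<noteq> 0" using det_G(1) by (auto simp: in_stab_iff)
  have "\<iota> (N$2$1) * z\<^sup>2 + \<iota> (N$2$2 - N$1$1) * z + \<iota> (- N$1$2) = 0"
    using N by (simp only: in_stab_iff moebius_fixes_iff[OF assms(1) NG(2)])
  from quadratic_form_factor[OF assms(1,3,4) this, of z']
  show "N \<in> stab z'" using NG(1) by (simp add: in_stab_iff moebius_fixes_iff[OF assms(2) NG(2)])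
qed

lemma stab_conj:
  assumes "z \<in> ell"
  shows "conj z \<in> ell" "stab (conj z) = stab z"
proof -
  obtain s p where sp: "z + conj z = \<iota> s" "z * conj z = \<iota> p"
    using conj_elliptic[OF assms] by blast
  have zK: "z \<notin> K_inf \<iota>" using assms by (simp add: in_ell_iff)
  \<comment> \<open>The trace lies in \<open>K\<close>, so \<open>conj z\<close> is an affine image
    of \<open>z\<close> over \<open>K\<close> and stays outside \<open>K_inf\<close>.\<close>
  have "conj z = \<iota> (- 1) * z + \<iota> s" unfolding sp(1)[symmetric] by simp
  then have cK: "conj z \<notin> K_inf \<iota>" using zK K_inf_affine_iff[of "- 1" z s] by simp
  have "z \<notin> range \<iota>" "conj z \<notin> range \<iota>" using zK cK range_subset_K_inf by blast+
  then show st: "stab (conj z) = stab z"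
    using stab_subset_conjugate[of z "conj z"] stab_subset_conjugate[of "conj z" z] sp
    by (simp add: ac_simps subset_antisym)
  show "conj z \<in> ell" using assms cK by (simp add: in_ell_iff st)
qed

lemma pair_eq_iff_stab_eq:
  assumes z: "z \<in> ell" and w: "w \<in> ell"
  shows "{z, conj z} = {w, conj w} \<longleftrightarrow> stab z = stab w"
proof
  assume "{z, conj z} = {w, conj w}"
  then have "w = z \<or> w = conj z" by blast
  then show "stab z = stab w" using stab_conj(2)[OF z] by blast
next
  assume eq: "stab z = stab w"
  from z obtain M where zK: "z \<notin> K_inf \<iota>" and M: "M \<in> stab z" "M \<notin> range mat"
    by (auto simp: in_ell_iff)
  have wK: "w \<notin> K_inf \<iota>" using w by (simp add: in_ell_iff)
  have r: "z \<notin> range \<iota>" "w \<notin> range \<iota>" using zK wK range_subset_K_inf by blast+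
  have det: "det M \<noteq> 0" using M(1) det_G(1) by (simp add: in_stab_iff)
  obtain s p where sp: "z + conj z = \<iota> s" "z * conj z = \<iota> p" and cc: "conj (conj z) = z"
    using conj_elliptic[OF z] by blast
  have qz: "\<iota> (M$2$1) * z\<^sup>2 + \<iota> (M$2$2 - M$1$1) * z + \<iota> (- M$1$2) = 0"
    using M(1) by (simp only: in_stab_iff moebius_fixes_iff[OF r(1) det])
  have "\<iota> (M$2$1) * w\<^sup>2 + \<iota> (M$2$2 - M$1$1) * w + \<iota> (- M$1$2) = 0"
    using M(1) unfolding eq by (simp only: in_stab_iff moebius_fixes_iff[OF r(2) det])
  \<comment> \<open>The form of \<open>M\<close> is \<open>c (x - z) (x - conj z)\<close> with
    \<open>c \<noteq> 0\<close>, so \<open>w\<close> must be one of its two zeros.\<close>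
  then have "\<iota> (M$2$1) * (w - z) * (w - conj z) = 0"
    by (simp only: quadratic_form_factor[OF r(1) sp qz])
  then have "w = z \<or> w = conj z" using eigenvalue(1)[OF zK M] by simp
  then show "{z, conj z} = {w, conj w}" using cc by auto
qed

text \<open>The action on pairs is that on stabilizers, transported along \<open>pair_eq_iff_stab_eq\<close>.\<close>
lemma action_on_pairs:
  "\<exists>\<phi>. group_action (AutoGroup G) (elliptic_pairs F \<iota> G) \<phi> \<and>
    (\<forall>\<sigma>\<in>carrier (AutoGroup G). \<forall>z\<in>ell. \<forall>w\<in>ell.
       \<sigma> ` stab z = stab w \<longrightarrow> \<phi> \<sigma> {z, conj z} = {w, conj w})"
proof -
  let ?E = "elliptic_pairs F \<iota> G"
  \<comment> \<open>Neither choice matters: representatives of a pair share a stabilizer, and a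
    stabilizer determines its pair. Restricting \<open>\<phi> \<sigma>\<close> to pairs gives the
    extensionality that \<open>Bij\<close> demands.\<close>
  define pick where "pick p = (SOME z. z \<in> ell \<and> p = {z, conj z})" for p
  define \<phi> where "\<phi> \<sigma> = (\<lambda>p\<in>?E. let w = (SOME w. w \<in> ell \<and> \<sigma> ` stab (pick p) = stab w) in {w, conj w})"
    for \<sigma> :: "'k^2^2 \<Rightarrow> 'k^2^2"
  have EI: "{z, conj z} \<in> ?E" if "z \<in> ell" for z using that by (auto simp: elliptic_pairs_def)
  have EE: "\<exists>z\<in>ell. p = {z, conj z}" if "p \<in> ?E" for p using that by (auto simp: elliptic_pairs_def)
  have pick: "stab (pick {z, conj z}) = stab z" if "z \<in> ell" for z
  proof -
    have "pick {z, conj z} \<in> ell \<and> {z, conj z} = {pick {z, conj z}, conj (pick {z, conj z})}"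
      unfolding pick_def by (rule someI[of _ z]) (use that in simp)
    with pair_eq_iff_stab_eq[OF that] show ?thesis by metis
  qed
  have \<phi>: "\<phi> \<sigma> {z, conj z} = {w, conj w}" if "z \<in> ell" "w \<in> ell" "\<sigma> ` stab z = stab w" for \<sigma> z w
  proof -
    define v where "v = (SOME v. v \<in> ell \<and> \<sigma> ` stab (pick {z, conj z}) = stab v)"
    have "v \<in> ell \<and> \<sigma> ` stab (pick {z, conj z}) = stab v"
      unfolding v_def by (rule someI[of _ w]) (use that pick in simp)
    then have "{v, conj v} = {w, conj w}"
      using pair_eq_iff_stab_eq[of v w] that pick by simp
    then show ?thesis using EI[OF that(1)] by (simp add: \<phi>_def v_def)
  qed
  interpret Aut: Group.group "AutoGroup G" by (rule group.AutoGroup[OF group_G])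
  have mult: "\<sigma> \<otimes>\<^bsub>AutoGroup G\<^esub> \<rho> = compose (carrier G) \<sigma> \<rho>"
    if "\<sigma> \<in> carrier (AutoGroup G)" "\<rho> \<in> carrier (AutoGroup G)" for \<sigma> \<rho>
    using that by (simp add: AutoGroup_def BijGroup_def auto_def)
  have one: "\<one>\<^bsub>AutoGroup G\<^esub> = (\<lambda>x\<in>carrier G. x)"
    by (simp add: AutoGroup_def BijGroup_def)
  have stab_sub: "stab z \<subseteq> carrier G" for z by (auto simp: in_stab_iff)
  have \<phi>_closed: "\<phi> \<sigma> p \<in> ?E" if "\<sigma> \<in> carrier (AutoGroup G)" "p \<in> ?E" for \<sigma> p
  proof -
    from EE[OF that(2)] obtain z where z: "z \<in> ell" "p = {z, conj z}" by blast
    from automorphism_maps_stab[OF that(1) z(1)] obtain w where "w \<in> ell" "\<sigma> ` stab z = stab w" by blast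
    with \<phi>[OF z(1)] EI z(2) show ?thesis by simp
  qed
  have \<phi>_mult: "\<phi> (\<sigma> \<otimes>\<^bsub>AutoGroup G\<^esub> \<rho>) p = \<phi> \<sigma> (\<phi> \<rho> p)"
    if \<sigma>: "\<sigma> \<in> carrier (AutoGroup G)" and \<rho>: "\<rho> \<in> carrier (AutoGroup G)" and p: "p \<in> ?E" for \<sigma> \<rho> p
  proof -
    from EE[OF p] obtain z where z: "z \<in> ell" "p = {z, conj z}" by blast
    from automorphism_maps_stab[OF \<rho> z(1)] obtain w where w: "w \<in> ell" "\<rho> ` stab z = stab w" by blast
    from automorphism_maps_stab[OF \<sigma> w(1)] obtain v where v: "v \<in> ell" "\<sigma> ` stab w = stab v" by blast
    \<comment> \<open>The product in \<open>AutoGroup G\<close> is composition restricted to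
      \<open>carrier G\<close>; stabilizers lie in there, so images compose as usual.\<close>
    have "(\<sigma> \<otimes>\<^bsub>AutoGroup G\<^esub> \<rho>) ` stab z = \<sigma> ` \<rho> ` stab z"
      unfolding mult[OF \<sigma> \<rho>] image_image using stab_sub[of z]
      by (intro image_cong) (auto simp: compose_def)
    then have "(\<sigma> \<otimes>\<^bsub>AutoGroup G\<^esub> \<rho>) ` stab z = stab v" using w v by simp
    from \<phi>[OF z(1) v(1) this] \<phi>[OF z(1) w] \<phi>[OF w(1) v] z(2) show ?thesis by simp
  qed
  have \<phi>_one: "\<phi> \<one>\<^bsub>AutoGroup G\<^esub> p = p" if "p \<in> ?E" for p
  proof -
    from EE[OF that] obtain z where z: "z \<in> ell" "p = {z, conj z}" by blast
    have "\<one>\<^bsub>AutoGroup G\<^esub> ` stab z = stab z"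
      unfolding one using stab_sub[of z] by (auto simp: image_iff subset_iff)
    from \<phi>[OF z(1) z(1) this] z(2) show ?thesis by simp
  qed
  \<comment> \<open>Bijectivity comes from the inverse automorphism, now that \<open>\<phi>\<close>
    respects products and the unit.\<close>
  have \<phi>_Bij: "\<phi> \<sigma> \<in> Bij ?E" if \<sigma>: "\<sigma> \<in> carrier (AutoGroup G)" for \<sigma>
  proof -
    let ?i = "inv\<^bsub>AutoGroup G\<^esub> \<sigma>"
    have i: "?i \<in> carrier (AutoGroup G)" using \<sigma> by simp
    have "bij_betw (\<phi> \<sigma>) ?E ?E"
    proof (rule bij_betw_byWitness[of _ "\<phi> ?i"])
      show "\<forall>p\<in>?E. \<phi> ?i (\<phi> \<sigma> p) = p" "\<forall>p\<in>?E. \<phi> \<sigma> (\<phi> ?i p) = p"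
        using \<phi>_mult[OF i \<sigma>] \<phi>_mult[OF \<sigma> i] \<phi>_one \<sigma> by simp_all
    qed (use \<phi>_closed \<sigma> i in auto)
    then show ?thesis by (simp add: Bij_def \<phi>_def)
  qed
  have "group_action (AutoGroup G) ?E \<phi>"
  proof (intro group_action.intro group_hom.intro group_hom_axioms.intro homI Aut.group_axioms
      group_BijGroup)
    show "\<phi> \<sigma> \<in> carrier (BijGroup ?E)" if "\<sigma> \<in> carrier (AutoGroup G)" for \<sigma>
      using \<phi>_Bij[OF that] by (simp add: BijGroup_def)
    show "\<phi> (\<sigma> \<otimes>\<^bsub>AutoGroup G\<^esub> \<rho>) = \<phi> \<sigma> \<otimes>\<^bsub>BijGroup ?E\<^esub> \<phi> \<rho>"
      if \<sigma>: "\<sigma> \<in> carrier (AutoGroup G)" and \<rho>: "\<rho> \<in> carrier (AutoGroup G)" for \<sigma> \<rho>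
    proof -
      have "\<phi> (\<sigma> \<otimes>\<^bsub>AutoGroup G\<^esub> \<rho>) = compose ?E (\<phi> \<sigma>) (\<phi> \<rho>)"
        by (rule extensionalityI[of _ ?E])
           (use \<phi>_Bij[OF Aut.m_closed[OF \<sigma> \<rho>]] \<phi>_mult[OF \<sigma> \<rho>] in \<open>auto simp: Bij_def compose_def\<close>)
      then show ?thesis using \<phi>_Bij[OF \<sigma>] \<phi>_Bij[OF \<rho>] by (simp add: BijGroup_def)
    qed
  qed
  with \<phi> show ?thesis by blast
qed

end

theorem theorem2p6:
  fixes F P :: "'k::field set"
    and \<iota> :: "'k \<Rightarrow> 'c::{field, complete_space}"
    and \<delta> :: nat
    and G :: "('k^2^2) monoid"
  assumes "function_field F"
    and "place F P" and "has_degree F P \<delta>" and "odd \<delta>"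
    and "place_completion P \<iota>"
  defines "G \<equiv> GL2 (integral_away F P)"
  shows
    "(\<forall>\<sigma> \<in> carrier (AutoGroup G). \<forall>\<omega> \<in> elliptic_points \<iota> G.
        \<exists>\<omega>\<^sub>0 \<in> elliptic_points \<iota> G.
          \<sigma> ` stabilizer G (moebius_map \<iota>) \<omega> = stabilizer G (moebius_map \<iota>) \<omega>\<^sub>0)
     \<and> (\<forall>\<sigma> \<in> carrier (AutoGroup G).
        \<forall>\<omega> \<in> elliptic_points \<iota> G. \<forall>\<omega>' \<in> elliptic_points \<iota> G.
        \<forall>\<omega>\<^sub>0 \<in> elliptic_points \<iota> G. \<forall>\<omega>\<^sub>0' \<in> elliptic_points \<iota> G.
          {\<omega>, conj_pt F \<iota> \<omega>} = {\<omega>', conj_pt F \<iota> \<omega>'} \<longrightarrow>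
          \<sigma> ` stabilizer G (moebius_map \<iota>) \<omega> = stabilizer G (moebius_map \<iota>) \<omega>\<^sub>0 \<longrightarrow>
          \<sigma> ` stabilizer G (moebius_map \<iota>) \<omega>' = stabilizer G (moebius_map \<iota>) \<omega>\<^sub>0' \<longrightarrow>
          {\<omega>\<^sub>0, conj_pt F \<iota> \<omega>\<^sub>0} = {\<omega>\<^sub>0', conj_pt F \<iota> \<omega>\<^sub>0'})
     \<and> (\<exists>\<phi>. group_action (AutoGroup G) (elliptic_pairs F \<iota> G) \<phi> \<and>
        (\<forall>\<sigma> \<in> carrier (AutoGroup G).
         \<forall>\<omega> \<in> elliptic_points \<iota> G. \<forall>\<omega>\<^sub>0 \<in> elliptic_points \<iota> G.
          \<sigma> ` stabilizer G (moebius_map \<iota>) \<omega> = stabilizer G (moebius_map \<iota>) \<omega>\<^sub>0 \<longrightarrow>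
          \<phi> \<sigma> {\<omega>, conj_pt F \<iota> \<omega>} = {\<omega>\<^sub>0, conj_pt F \<iota> \<omega>\<^sub>0}))"
proof -
  interpret place_completion P \<iota> by fact
  interpret drinfeld_half_plane P \<iota> F
    by (intro drinfeld_half_plane.intro drinfeld_half_plane_axioms.intro assms)
  show ?thesis
    unfolding G_def using automorphism_maps_stab pair_eq_iff_stab_eq action_on_pairs
    by (intro conjI) auto
qed

end
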